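(* Let $\mathcal{D}=(D,Q)$ be a discriminant form of even signature, $k\in\mathbb{Z}$, $H_1,\dots,H_n$ arbitrary isotropic subgroups of $D$, and $F\in M_k(\mathcal{D})$. Then $F$ is an oldform with respect to $H_1,\dots,H_n$ (i.e. there exist $G_i\in M_k(\mathcal{D}_{H_i})$ with $F=\sum_{i=1}^n G_i\!\uparrow_{H_i}$) if and only if $\ker(\downarrow)\subseteq\ker(\mathcal{F})$, where $\downarrow=(\downarrow_{H_1},\dots,\downarrow_{H_n}):\mathbb{C}[D]\to\bigoplus_{i=1}^n\mathbb{C}[H_i^\perp/H_i]$ and $\mathcal{F}:\mathbb{C}[D]\to\{\text{functions }\mathbb{H}\to\mathbb{C}\}$ is the $\mathbb{C}$-linear map with $\mathcal{F}(\mathfrak{e}_\gamma)=F_\gamma$.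
   Context: Discriminant form $\mathcal{D}=(D,Q)$: finite abelian group with $Q:D\to\mathbb{Q}/\mathbb{Z}$, $Q(a\gamma)=a^2Q(\gamma)$, and $(\gamma,\delta)=Q(\gamma+\delta)-Q(\gamma)-Q(\delta)$ a nondegenerate bilinear form; signature defined by $\sum_\gamma e(Q(\gamma))=\sqrt{|D|}e(\operatorname{sign}/8)$, $e(x)=\exp(2\pi ix)$. Weil representation $\rho$ on $\mathbb{C}[D]$ (basis $\mathfrak{e}_\gamma$): $\rho(T)\mathfrak{e}_\gamma=e(Q(\gamma))\mathfrak{e}_\gamma$, $\rho(S)\mathfrak{e}_\gamma=\frac{e(-\operatorname{sign}/8)}{\sqrt{|D|}}\sum_\beta e(-(\gamma,\beta))\mathfrak{e}_\beta$. $M_k(\mathcal{D})$: holomorphic $F=\sum_\gamma F_\gamma\mathfrak{e}_\gamma:\mathbb{H}\to\mathbb{C}[D]$ with $F(M\tau)=(c\tau+d)^k\rho(M)F(\tau)$ for all $M\in\mathrm{SL}_2(\mathbb{Z})$, bounded as $\operatorname{Im}\tau\to\infty$. Isotropic subgroup $H$: $Q(H)=0$; $D_H=H^\perp/H$ with $Q_H(\gamma+H)=Q(\gamma)$ is a discriminant form $\mathcal{D}_H$. Algebraic down map $\downarrow_H:\mathbb{C}[D]\to\mathbb{C}[D_H]$: $\mathfrak{e}_\gamma\mapsto\mathfrak{e}_{\gamma+H}$ if $\gamma\in H^\perp$, $\mathfrak{e}_\gamma\mapsto 0$ otherwise. For $G=\sum_\alpha G_\alpha\mathfrak{e}_\alpha\in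 M_k(\mathcal{D}_H)$, $G\!\uparrow_H:=\sum_{\gamma\in H^\perp}G_{\gamma+H}\mathfrak{e}_\gamma$. *)

theory Defs
  imports "HOL-Analysis.Analysis" "HOL-Algebra.Coset"
begin

subsection \<open>The group \<open>\<rat>/\<int>\<close>\<close>

definition qz_rel :: "rat \<Rightarrow> rat \<Rightarrow> bool" where
  "qz_rel x y \<longleftrightarrow> x - y \<in> \<int>"

lemma equivp_qz_rel: "equivp qz_rel"
proof (rule equivpI)
  show "reflp qz_rel"
    by (auto simp: reflp_def qz_rel_def)
  show "symp qz_rel"
    unfolding symp_def qz_rel_def by (metis Ints_minus minus_diff_eq)
  show "transp qz_rel"
    unfolding transp_def qz_rel_def by (metis Ints_add diff_add_cancel add_diff_eq)
qed

quotient_type qz = rat / qz_rel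
  by (rule equivp_qz_rel)

instantiation qz :: ab_group_add
begin

lift_definition zero_qz :: qz is "0 :: rat" .

lift_definition plus_qz :: "qz \<Rightarrow> qz \<Rightarrow> qz" is "(+) :: rat \<Rightarrow> rat \<Rightarrow> rat"
  unfolding qz_rel_def by (metis Ints_add add_diff_add)

lift_definition uminus_qz :: "qz \<Rightarrow> qz" is "uminus :: rat \<Rightarrow> rat"
  unfolding qz_rel_def by (metis Ints_minus minus_diff_minus)

lift_definition minus_qz :: "qz \<Rightarrow> qz \<Rightarrow> qz" is "(-) :: rat \<Rightarrow> rat \<Rightarrow> rat"
  unfolding qz_rel_def by (metis Ints_diff diff_diff_eq2 diff_diff_eq add_diff_eq diff_add_eq add.commute)

instance
  by standard (transfer, simp add: qz_rel_def)+

end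

lift_definition qz_scale :: "int \<Rightarrow> qz \<Rightarrow> qz" is "\<lambda>a x. of_int a * x"
  unfolding qz_rel_def by (metis Ints_mult Ints_of_int right_diff_distrib)

definition ee :: "complex \<Rightarrow> complex" where
  "ee z = exp (2 * of_real pi * \<i> * z)"

lift_definition qz_ee :: "qz \<Rightarrow> complex" is "\<lambda>x. ee (of_rat x)"
proof -
  fix x y :: rat
  assume "qz_rel x y"
  then obtain n :: int where n: "x - y = of_int n"
    unfolding qz_rel_def by (auto elim: Ints_cases)
  then have "x = y + of_int n" by simp
  then have "ee (of_rat x) = exp (2 * of_real pi * \<i> * of_rat y + 2 * of_int n * of_real pi * \<i>)"
    by (simp add: ee_def of_rat_add algebra_simps)
  also have "\<dots> = ee (of_rat y) * exp (2 * of_int n * of_real pi * \<i>)"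
    by (simp only: ee_def exp_add)
  also have "exp (2 * of_int n * of_real pi * \<i>) = (1 :: complex)"
    by (simp add: exp_eq_1)
  finally show "ee (of_rat x) = ee (of_rat y)" by simp
qed

subsection \<open>Discriminant forms\<close>

text \<open>The group is written multiplicatively, as is customary for \<^locale>\<open>comm_group\<close>:
  \<open>\<gamma> \<otimes> \<delta>\<close> is \<open>\<gamma> + \<delta>\<close>, \<open>\<gamma> [^] a\<close> is \<open>a\<gamma>\<close>, and \<open>H #> \<gamma>\<close> is the coset \<open>\<gamma> + H\<close>.\<close>

definition bil :: "('a, 'b) monoid_scheme \<Rightarrow> ('a \<Rightarrow> qz) \<Rightarrow> 'a \<Rightarrow> 'a \<Rightarrow> qz" where
  "bil D Q \<gamma> \<delta> = Q (\<gamma> \<otimes>\<^bsub>D\<^esub> \<delta>) - Q \<gamma> - Q \<delta>"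

definition discriminant_form :: "('a, 'b) monoid_scheme \<Rightarrow> ('a \<Rightarrow> qz) \<Rightarrow> bool" where
  "discriminant_form D Q \<longleftrightarrow>
     comm_group D \<and> finite (carrier D) \<and>
     (\<forall>\<gamma>\<in>carrier D. \<forall>a::int. Q (\<gamma> [^]\<^bsub>D\<^esub> a) = qz_scale (a\<^sup>2) (Q \<gamma>)) \<and>
     (\<forall>\<gamma>\<in>carrier D. \<forall>\<gamma>'\<in>carrier D. \<forall>\<delta>\<in>carrier D.
        bil D Q (\<gamma> \<otimes>\<^bsub>D\<^esub> \<gamma>') \<delta> = bil D Q \<gamma> \<delta> + bil D Q \<gamma>' \<delta> \<and>
        bil D Q \<delta> (\<gamma> \<otimes>\<^bsub>D\<^esub> \<gamma>') = bil D Q \<delta> \<gamma> + bil D Q \<delta> \<gamma>') \<and>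
     (\<forall>\<gamma>\<in>carrier D. (\<forall>\<delta>\<in>carrier D. bil D Q \<gamma> \<delta> = 0) \<longrightarrow> \<gamma> = \<one>\<^bsub>D\<^esub>)"

text \<open>The Gauss sum determines the signature modulo 8 only; \<open>disc_sign\<close> is its representative
  in \<open>{0..<8}\<close>.\<close>

definition is_signature :: "('a, 'b) monoid_scheme \<Rightarrow> ('a \<Rightarrow> qz) \<Rightarrow> int \<Rightarrow> bool" where
  "is_signature D Q s \<longleftrightarrow>
     (\<Sum>\<gamma>\<in>carrier D. qz_ee (Q \<gamma>)) = of_real (sqrt (real (card (carrier D)))) * ee (of_int s / 8)"

definition disc_sign :: "('a, 'b) monoid_scheme \<Rightarrow> ('a \<Rightarrow> qz) \<Rightarrow> int" where
  "disc_sign D Q = (THE s. s \<in> {0..<8} \<and> is_signature D Q s)"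

definition even_signature :: "('a, 'b) monoid_scheme \<Rightarrow> ('a \<Rightarrow> qz) \<Rightarrow> bool" where
  "even_signature D Q \<longleftrightarrow> (\<exists>s. is_signature D Q s \<and> even s)"

definition isotropic_subgroup :: "('a, 'b) monoid_scheme \<Rightarrow> ('a \<Rightarrow> qz) \<Rightarrow> 'a set \<Rightarrow> bool" where
  "isotropic_subgroup D Q H \<longleftrightarrow> subgroup H D \<and> (\<forall>\<gamma>\<in>H. Q \<gamma> = 0)"

definition orth :: "('a, 'b) monoid_scheme \<Rightarrow> ('a \<Rightarrow> qz) \<Rightarrow> 'a set \<Rightarrow> 'a set" where
  "orth D Q H = {\<gamma> \<in> carrier D. \<forall>\<delta>\<in>H. bil D Q \<gamma> \<delta> = 0}"

definition quot_group :: "('a, 'b) monoid_scheme \<Rightarrow> ('a \<Rightarrow> qz) \<Rightarrow> 'a set \<Rightarrow> 'a set monoid" where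
  "quot_group D Q H = (D\<lparr>carrier := orth D Q H\<rparr>) Mod H"

text \<open>For isotropic \<open>H\<close>, \<open>Q\<close> is constant on each coset of \<open>H\<close> contained in \<open>orth D Q H\<close>.\<close>

definition quot_form :: "('a \<Rightarrow> qz) \<Rightarrow> 'a set \<Rightarrow> qz" where
  "quot_form Q \<alpha> = the_elem (Q ` \<alpha>)"

subsection \<open>The Weil representation\<close>

text \<open>Elements of \<open>\<complex>[D]\<close> are coefficient functions vanishing outside the carrier of \<open>D\<close>.\<close>

definition group_alg :: "('a, 'b) monoid_scheme \<Rightarrow> ('a \<Rightarrow> complex) set" where
  "group_alg D = {v. \<forall>\<gamma>. \<gamma> \<notin> carrier D \<longrightarrow> v \<gamma> = 0}"

definition basis_vec :: "'a \<Rightarrow> 'a \<Rightarrow> complex" where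
  "basis_vec \<gamma> = (\<lambda>\<beta>. if \<beta> = \<gamma> then 1 else 0)"

definition SL2Z :: "(int ^ 2 ^ 2) set" where
  "SL2Z = {M. det M = 1}"

definition matT :: "int ^ 2 ^ 2" where
  "matT = vector [vector [1, 1], vector [0, 1]]"

definition matS :: "int ^ 2 ^ 2" where
  "matS = vector [vector [0, -1], vector [1, 0]]"

text \<open>As \<open>S\<close> and \<open>T\<close> generate \<open>SL\<^sub>2(\<int>)\<close>, the following properties determine the
  action of \<open>\<rho>\<close> on \<open>\<complex>[D]\<close>; such a \<open>\<rho>\<close> exists exactly when the signature is even.\<close>

definition weil_representation ::
  "('a, 'b) monoid_scheme \<Rightarrow> ('a \<Rightarrow> qz) \<Rightarrow> (int ^ 2 ^ 2 \<Rightarrow> ('a \<Rightarrow> complex) \<Rightarrow> ('a \<Rightarrow> complex)) \<Rightarrow> bool"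
where
  "weil_representation D Q \<rho> \<longleftrightarrow>
     (\<forall>M\<in>SL2Z. \<forall>v\<in>group_alg D. \<rho> M v \<in> group_alg D) \<and>
     (\<forall>M\<in>SL2Z. \<forall>v\<in>group_alg D. \<forall>w\<in>group_alg D. \<forall>a b.
        \<rho> M (\<lambda>\<gamma>. a * v \<gamma> + b * w \<gamma>) = (\<lambda>\<gamma>. a * \<rho> M v \<gamma> + b * \<rho> M w \<gamma>)) \<and>
     (\<forall>v\<in>group_alg D. \<rho> (mat 1) v = v) \<and>
     (\<forall>M\<in>SL2Z. \<forall>N\<in>SL2Z. \<forall>v\<in>group_alg D. \<rho> (M ** N) v = \<rho> M (\<rho> N v)) \<and>
     (\<forall>\<gamma>\<in>carrier D. \<rho> matT (basis_vec \<gamma>) = (\<lambda>\<delta>. qz_ee (Q \<gamma>) * basis_vec \<gamma> \<delta>)) \<and>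
     (\<forall>\<gamma>\<in>carrier D. \<rho> matS (basis_vec \<gamma>) =
        (\<lambda>\<delta>. ee (- of_int (disc_sign D Q) / 8) / of_real (sqrt (real (card (carrier D)))) *
             (\<Sum>\<beta>\<in>carrier D. qz_ee (- bil D Q \<gamma> \<beta>) * basis_vec \<beta> \<delta>)))"

subsection \<open>Vector-valued modular forms\<close>

definition upper_half_plane :: "complex set" where
  "upper_half_plane = {\<tau>. Im \<tau> > 0}"

definition moebius_act :: "int ^ 2 ^ 2 \<Rightarrow> complex \<Rightarrow> complex" where
  "moebius_act M \<tau> = (of_int (M $ 1 $ 1) * \<tau> + of_int (M $ 1 $ 2)) /
                      (of_int (M $ 2 $ 1) * \<tau> + of_int (M $ 2 $ 2))"

text \<open>A form is a function \<open>F\<close> of \<open>\<tau>\<close> with component \<open>F\<^sub>\<gamma>(\<tau>) = F \<tau> \<gamma>\<close>; its values at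
  \<open>\<tau>\<close> outside the upper half-plane are irrelevant.\<close>

definition modular_forms ::
  "int \<Rightarrow> ('a, 'b) monoid_scheme \<Rightarrow> ('a \<Rightarrow> qz) \<Rightarrow> (complex \<Rightarrow> 'a \<Rightarrow> complex) set" where
  "modular_forms k D Q = {F.
     (\<forall>\<tau>\<in>upper_half_plane. F \<tau> \<in> group_alg D) \<and>
     (\<forall>\<gamma>\<in>carrier D. (\<lambda>\<tau>. F \<tau> \<gamma>) holomorphic_on upper_half_plane) \<and>
     (\<exists>\<rho>. weil_representation D Q \<rho> \<and>
        (\<forall>M\<in>SL2Z. \<forall>\<tau>\<in>upper_half_plane.
           F (moebius_act M \<tau>) =
           (\<lambda>\<gamma>. (of_int (M $ 2 $ 1) * \<tau> + of_int (M $ 2 $ 2)) powi k * \<rho> M (F \<tau>) \<gamma>))) \<and>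
     (\<forall>\<gamma>\<in>carrier D. \<exists>B y. \<forall>\<tau>\<in>upper_half_plane. Im \<tau> \<ge> y \<longrightarrow> norm (F \<tau> \<gamma>) \<le> B)}"

definition down :: "('a, 'b) monoid_scheme \<Rightarrow> ('a \<Rightarrow> qz) \<Rightarrow> 'a set \<Rightarrow> ('a \<Rightarrow> complex) \<Rightarrow> 'a set \<Rightarrow> complex"
where
  "down D Q H v = (\<lambda>\<alpha>. \<Sum>\<gamma>\<in>orth D Q H. v \<gamma> * basis_vec (H #>\<^bsub>D\<^esub> \<gamma>) \<alpha>)"

definition up ::
  "('a, 'b) monoid_scheme \<Rightarrow> ('a \<Rightarrow> qz) \<Rightarrow> 'a set \<Rightarrow> (complex \<Rightarrow> 'a set \<Rightarrow> complex) \<Rightarrow> complex \<Rightarrow> 'a \<Rightarrow> complex"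
where
  "up D Q H G \<tau> = (\<lambda>\<delta>. \<Sum>\<gamma>\<in>orth D Q H. G \<tau> (H #>\<^bsub>D\<^esub> \<gamma>) * basis_vec \<gamma> \<delta>)"

definition oldform ::
  "int \<Rightarrow> ('a, 'b) monoid_scheme \<Rightarrow> ('a \<Rightarrow> qz) \<Rightarrow> nat \<Rightarrow> (nat \<Rightarrow> 'a set) \<Rightarrow> (complex \<Rightarrow> 'a \<Rightarrow> complex) \<Rightarrow> bool"
where
  "oldform k D Q n H F \<longleftrightarrow>
     (\<exists>G. (\<forall>i\<in>{1..n}. G i \<in> modular_forms k (quot_group D Q (H i)) (quot_form Q)) \<and>
          (\<forall>\<tau>\<in>upper_half_plane. F \<tau> = (\<lambda>\<gamma>. \<Sum>i=1..n. up D Q (H i) (G i) \<tau> \<gamma>)))"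

definition ker_down ::
  "('a, 'b) monoid_scheme \<Rightarrow> ('a \<Rightarrow> qz) \<Rightarrow> nat \<Rightarrow> (nat \<Rightarrow> 'a set) \<Rightarrow> ('a \<Rightarrow> complex) set" where
  "ker_down D Q n H = {v \<in> group_alg D. \<forall>i\<in>{1..n}. down D Q (H i) v = (\<lambda>_. 0)}"

definition form_map ::
  "('a, 'b) monoid_scheme \<Rightarrow> (complex \<Rightarrow> 'a \<Rightarrow> complex) \<Rightarrow> ('a \<Rightarrow> complex) \<Rightarrow> complex \<Rightarrow> complex" where
  "form_map D F v = (\<lambda>\<tau>. \<Sum>\<gamma>\<in>carrier D. v \<gamma> * F \<tau> \<gamma>)"

definition ker_form_map ::
  "('a, 'b) monoid_scheme \<Rightarrow> (complex \<Rightarrow> 'a \<Rightarrow> complex) \<Rightarrow> ('a \<Rightarrow> complex) set" where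
  "ker_form_map D F = {v \<in> group_alg D. \<forall>\<tau>\<in>upper_half_plane. form_map D F v \<tau> = 0}"

end

theory Submission
  imports Defs
begin

text \<open>The map \<open>\<up>\<close> is the transpose of \<open>\<down>\<close>, so \<open>ker \<down> \<subseteq> ker F\<close> says that every
  \<open>F(\<tau>)\<close> is orthogonal to the kernel of the real symmetric operator
  \<open>A = \<Sum>\<^sub>i \<up>\<^sub>i \<down>\<^sub>i\<close> on \<open>\<complex>[D]\<close>. There \<open>A\<close> is inverted by a polynomial \<open>B\<close> in \<open>A\<close>.
  Since \<open>A\<close> commutes with \<open>\<rho>(S)\<close> and \<open>\<rho>(T)\<close>, hence with the Weil representation, so
  does \<open>B\<close>. Therefore the forms \<open>G\<^sub>i = \<down>\<^sub>i B F\<close> are modular, and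
  \<open>\<Sum>\<^sub>i \<up>\<^sub>i G\<^sub>i = A B F = F\<close>.\<close>

section \<open>Generation of the modular group\<close>

text \<open>The obstacle is choice: the images of the maps \<open>up\<close> for different
  \<open>H i\<close> overlap, so a value \<open>F \<tau>\<close> has many decompositions, while the
  selected one must vary holomorphically with \<tau> and respect every \<open>\<rho> M\<close>. One
  fixed linear operator commuting with the representation settles both at once. That the kernel of
  \<open>A\<close> is the common kernel of the \<open>down\<close> maps is a positivity fact: the
  pairing of the conjugate of \<open>z\<close> with \<open>A z\<close> is the sum of the squared
  norms of the vectors \<open>down D Q (H i) z\<close>. The pairing itself carries no conjugation,
  as it has to agree with \<open>form_map\<close>; conjugates can enter because \<open>A\<close> has
  real coefficients. Modularity on a quotient also demands a Weil representation there, although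
  explicit formulas exist only for S and T. It is obtained by transporting \<rho> along
  \<open>down\<close>, which is well defined because up after down commutes with \<rho>. Its formula
  for S has the right constant because passing to the quotient divides both the Gauss sum and the
  square root of the group order by \<open>card H\<close>, leaving the signature unchanged.\<close>

lemma mat2_eq_vector:
  fixes M :: "int ^ 2 ^ 2"
  shows "M = vector [vector [M $ 1 $ 1, M $ 1 $ 2], vector [M $ 2 $ 1, M $ 2 $ 2]]"
  by (simp add: vec_eq_iff forall_2)

lemma matS_mult:
  "matS ** vector [vector [a, b], vector [c, d]] = (vector [vector [- c, - d], vector [a, b]] :: int ^ 2 ^ 2)"
  by (simp add: vec_eq_iff forall_2 matS_def matrix_matrix_mult_def sum_2)

lemma matT_mult:
  "matT ** vector [vector [a, b], vector [c, d]] = (vector [vector [a + c, b + d], vector [c, d]] :: int ^ 2 ^ 2)"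
  by (simp add: vec_eq_iff forall_2 matT_def matrix_matrix_mult_def sum_2)

lemma matS_in_SL2Z: "matS \<in> SL2Z" and matT_in_SL2Z: "matT \<in> SL2Z"
  by (simp_all add: SL2Z_def matS_def matT_def det_2)

lemma mat_1_in_SL2Z: "mat 1 \<in> SL2Z"
  by (simp add: SL2Z_def)

lemma mult_in_SL2Z: "M \<in> SL2Z \<Longrightarrow> N \<in> SL2Z \<Longrightarrow> M ** N \<in> SL2Z"
  by (simp add: SL2Z_def det_mul)

text \<open>The Euclidean algorithm on the first column. Only left multiplication by S and T is
  assumed to preserve \<open>P\<close>; the inverses come from the relations \<open>S^2 = -1\<close>
  and \<open>(S T)^3 = -1\<close>.\<close>

lemma int_quadruple_SL2_induct:
  fixes P :: "int \<Rightarrow> int \<Rightarrow> int \<Rightarrow> int \<Rightarrow> bool"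
  assumes det: "a * d - b * c = 1" and one: "P 1 0 0 1"
    and S: "\<And>a b c d. P a b c d \<Longrightarrow> P (- c) (- d) a b"
    and T: "\<And>a b c d. P a b c d \<Longrightarrow> P (a + c) (b + d) c d"
  shows "P a b c d"
proof -
  have neg: "P (- a) (- b) (- c) (- d)" if "P a b c d" for a b c d
    using S[OF S[OF that]] by simp
  have S': "P c d (- a) (- b)" if "P a b c d" for a b c d
    using neg[OF S[OF that]] by simp
  \<comment> \<open>\<open>T\<^sup>-\<^sup>1 = S\<^sup>-\<^sup>1 T S T S\<close>\<close>
  have T': "P (a - c) (b - d) c d" if "P a b c d" for a b c d
    using S'[OF T[OF S[OF T[OF S[OF that]]]]] by (simp add: algebra_simps)
  have Tnat: "P (a + int m * c) (b + int m * d) c d" if "P a b c d" for a b c d m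
    by (induction m) (use that T in \<open>force simp: algebra_simps\<close>)+
  have Tnat': "P (a - int m * c) (b - int m * d) c d" if "P a b c d" for a b c d m
  proof (induction m)
    case (Suc m)
    from T'[OF Suc] show ?case by (simp add: algebra_simps)
  qed (use that in simp)
  have Tint: "P (a + q * c) (b + q * d) c d" if "P a b c d" for a b c d q
  proof (cases "q \<ge> 0")
    case True
    then show ?thesis using Tnat[OF that, of "nat q"] by simp
  next
    case False
    then show ?thesis using Tnat'[OF that, of "nat (- q)"] by simp
  qed
  show ?thesis
    using det
  proof (induction "nat \<bar>c\<bar>" arbitrary: a b c d rule: less_induct)
    case less
    show ?case
    proof (cases "c = 0")
      case True
      with less.prems have "a * d = 1" by simp
      then consider "a = 1" "d = 1" | "a = - 1" "d = - 1"
        using zmult_eq_1_iff by blast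
      then show ?thesis
      proof cases
        case 1
        then show ?thesis using Tint[OF one, of b] True by simp
      next
        case 2
        then show ?thesis using neg[OF Tint[OF one, of "- b"]] True by simp
      qed
    next
      case False
      \<comment> \<open>The quadruple below is \<open>S T^(-q) M\<close>; its lower left entry is
        \<open>a mod c\<close>, smaller than \<open>c\<close> in absolute value. Undoing S and then
        \<open>T^(-q)\<close> returns to \<open>M\<close>.\<close>
      let ?q = "a div c"
      have "P (- c) (- d) (a mod c) (b - ?q * d)"
      proof (rule less.hyps)
        show "nat \<bar>a mod c\<bar> < nat \<bar>c\<bar>"
          using False by (simp add: abs_mod_less)
        show "(- c) * (b - ?q * d) - (- d) * (a mod c) = 1"
          using less.prems by (simp add: algebra_simps minus_div_mult_eq_mod[symmetric])
      qed
      from Tint[OF S'[OF this], of ?q] show ?thesis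
        by (simp add: algebra_simps)
    qed
  qed
qed

text \<open>Turns the formulas of the Weil representation for S and T into statements about
  \<open>\<rho> M\<close> for every \<open>M\<close>.\<close>

lemma SL2Z_induct:
  assumes "M \<in> SL2Z" and "P (mat 1)"
    and "\<And>M. M \<in> SL2Z \<Longrightarrow> P M \<Longrightarrow> P (matS ** M)"
    and "\<And>M. M \<in> SL2Z \<Longrightarrow> P M \<Longrightarrow> P (matT ** M)"
  shows "P M"
proof -
  let ?mk = "\<lambda>a b c d::int. vector [vector [a, b], vector [c, d]] :: int ^ 2 ^ 2"
  have one: "?mk 1 0 0 1 = mat 1"
    by (simp add: vec_eq_iff forall_2 mat_def)
  have "?mk (M $ 1 $ 1) (M $ 1 $ 2) (M $ 2 $ 1) (M $ 2 $ 2) \<in> SL2Z \<and>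
        P (?mk (M $ 1 $ 1) (M $ 1 $ 2) (M $ 2 $ 1) (M $ 2 $ 2))"
  proof (rule int_quadruple_SL2_induct[where P = "\<lambda>a b c d. ?mk a b c d \<in> SL2Z \<and> P (?mk a b c d)"])
    show "M $ 1 $ 1 * M $ 2 $ 2 - M $ 1 $ 2 * M $ 2 $ 1 = 1"
      using assms(1) by (simp add: SL2Z_def det_2)
    show "?mk 1 0 0 1 \<in> SL2Z \<and> P (?mk 1 0 0 1)"
      using assms(2) by (simp add: one mat_1_in_SL2Z)
    show "?mk (- c) (- d) a b \<in> SL2Z \<and> P (?mk (- c) (- d) a b)"
      if "?mk a b c d \<in> SL2Z \<and> P (?mk a b c d)" for a b c d
      using that assms(3) mult_in_SL2Z[OF matS_in_SL2Z] by (metis matS_mult)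
    show "?mk (a + c) (b + d) c d \<in> SL2Z \<and> P (?mk (a + c) (b + d) c d)"
      if "?mk a b c d \<in> SL2Z \<and> P (?mk a b c d)" for a b c d
      using that assms(4) mult_in_SL2Z[OF matT_in_SL2Z] by (metis matT_mult)
  qed
  then show ?thesis
    by (metis mat2_eq_vector)
qed

section \<open>Linear maps between group algebras\<close>

text \<open>Group algebras are sets of functions, so linearity is relative to them. The two-term
  form repeats the linearity clause of \<open>weil_representation\<close>.\<close>

definition alg_linear ::
  "('a, 'b) monoid_scheme \<Rightarrow> ('c, 'd) monoid_scheme \<Rightarrow> (('a \<Rightarrow> complex) \<Rightarrow> 'c \<Rightarrow> complex) \<Rightarrow> bool"
where
  "alg_linear D E L \<longleftrightarrow>
     (\<forall>v\<in>group_alg D. L v \<in> group_alg E) \<and>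
     (\<forall>v\<in>group_alg D. \<forall>w\<in>group_alg D. \<forall>a b.
        L (\<lambda>\<gamma>. a * v \<gamma> + b * w \<gamma>) = (\<lambda>\<gamma>. a * L v \<gamma> + b * L w \<gamma>))"

lemma alg_linear_mem: "alg_linear D E L \<Longrightarrow> v \<in> group_alg D \<Longrightarrow> L v \<in> group_alg E"
  by (simp add: alg_linear_def)

lemma alg_linear_comb:
  "alg_linear D E L \<Longrightarrow> v \<in> group_alg D \<Longrightarrow> w \<in> group_alg D \<Longrightarrow>
   L (\<lambda>\<gamma>. a * v \<gamma> + b * w \<gamma>) = (\<lambda>\<gamma>. a * L v \<gamma> + b * L w \<gamma>)"
  by (simp add: alg_linear_def)

lemma alg_linear_scale:
  "alg_linear D E L \<Longrightarrow> v \<in> group_alg D \<Longrightarrow> L (\<lambda>\<gamma>. a * v \<gamma>) = (\<lambda>\<gamma>. a * L v \<gamma>)"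
  using alg_linear_comb[of D E L v v a 0] by simp

lemma group_alg_zero: "(\<lambda>_. 0) \<in> group_alg D"
  by (simp add: group_alg_def)

lemma group_alg_sum:
  "(\<And>j. j \<in> J \<Longrightarrow> v j \<in> group_alg D) \<Longrightarrow> (\<lambda>\<gamma>. \<Sum>j\<in>J. a j * v j \<gamma>) \<in> group_alg D"
  by (simp add: group_alg_def)

lemma group_alg_basis_vec: "\<gamma> \<in> carrier D \<Longrightarrow> basis_vec \<gamma> \<in> group_alg D"
  by (auto simp: group_alg_def basis_vec_def)

lemma alg_linear_zero: "alg_linear D E L \<Longrightarrow> L (\<lambda>_. 0) = (\<lambda>_. 0)"
  using alg_linear_scale[of D E L "\<lambda>_. 0" 0] by (simp add: group_alg_zero)

lemma alg_linear_sum: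
  assumes L: "alg_linear D E L" and "finite J" and "\<And>j. j \<in> J \<Longrightarrow> v j \<in> group_alg D"
  shows "L (\<lambda>\<gamma>. \<Sum>j\<in>J. a j * v j \<gamma>) = (\<lambda>\<gamma>. \<Sum>j\<in>J. a j * L (v j) \<gamma>)"
  using assms(2,3)
proof (induction J rule: finite_induct)
  case empty
  then show ?case using alg_linear_zero[OF L] by simp
next
  case (insert i J)
  have "L (\<lambda>\<gamma>. a i * v i \<gamma> + 1 * (\<Sum>j\<in>J. a j * v j \<gamma>)) =
        (\<lambda>\<gamma>. a i * L (v i) \<gamma> + 1 * L (\<lambda>\<gamma>. \<Sum>j\<in>J. a j * v j \<gamma>) \<gamma>)"
    using insert.prems by (intro alg_linear_comb[OF L] group_alg_sum) auto
  then show ?case using insert by simp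
qed

lemma group_alg_expand:
  assumes "finite (carrier D)" "v \<in> group_alg D"
  shows "v = (\<lambda>\<delta>. \<Sum>\<gamma>\<in>carrier D. v \<gamma> * basis_vec \<gamma> \<delta>)"
  using assms by (auto simp: group_alg_def basis_vec_def fun_eq_iff if_distrib[of "(*) _"] cong: if_cong)

lemma alg_linear_expand:
  assumes "alg_linear D E L" "finite (carrier D)" "v \<in> group_alg D"
  shows "L v = (\<lambda>\<delta>. \<Sum>\<gamma>\<in>carrier D. v \<gamma> * L (basis_vec \<gamma>) \<delta>)"
  using alg_linear_sum[OF assms(1,2), of basis_vec v] group_alg_expand[OF assms(2,3)]
  by (simp add: group_alg_basis_vec)

lemma alg_linear_comp:
  "alg_linear D E L \<Longrightarrow> alg_linear E E' L' \<Longrightarrow> alg_linear D E' (\<lambda>v. L' (L v))"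
  by (simp add: alg_linear_def)

lemma alg_linear_funpow: "alg_linear D D L \<Longrightarrow> alg_linear D D (L ^^ j)"
  by (induction j) (simp_all add: alg_linear_def)

lemma alg_linear_lincomb:
  assumes "\<And>j. j \<in> J \<Longrightarrow> alg_linear D E (L j)"
  shows "alg_linear D E (\<lambda>v \<gamma>. \<Sum>j\<in>J. a j * L j v \<gamma>)"
  unfolding alg_linear_def
proof (intro conjI ballI allI)
  show "(\<lambda>\<gamma>. \<Sum>j\<in>J. a j * L j v \<gamma>) \<in> group_alg E" if "v \<in> group_alg D" for v
    by (rule group_alg_sum) (rule alg_linear_mem[OF assms that])
next
  fix v w s t
  assume v: "v \<in> group_alg D" and w: "w \<in> group_alg D"
  have "(\<Sum>j\<in>J. a j * L j (\<lambda>\<gamma>. s * v \<gamma> + t * w \<gamma>) \<gamma>) =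
        (\<Sum>j\<in>J. s * (a j * L j v \<gamma>) + t * (a j * L j w \<gamma>))" for \<gamma>
    by (intro sum.cong refl) (simp add: alg_linear_comb[OF assms v w] algebra_simps)
  then show "(\<lambda>\<gamma>. \<Sum>j\<in>J. a j * L j (\<lambda>\<gamma>. s * v \<gamma> + t * w \<gamma>) \<gamma>) =
    (\<lambda>\<gamma>. s * (\<Sum>j\<in>J. a j * L j v \<gamma>) + t * (\<Sum>j\<in>J. a j * L j w \<gamma>))"
    by (simp add: sum.distrib sum_distrib_left)
qed

text \<open>Gaussian elimination, one coordinate of \<open>S\<close> at a time. Applied to the
  matrix entries of the powers of an operator, it supplies an annihilating polynomial.\<close>

lemma linear_dependence:
  fixes f :: "'i \<Rightarrow> 's \<Rightarrow> 'f::field"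
  assumes "finite S" "finite J" "card S < card J"
  shows "\<exists>c. (\<exists>j\<in>J. c j \<noteq> 0) \<and> (\<forall>s\<in>S. (\<Sum>j\<in>J. c j * f j s) = 0)"
  using assms
proof (induction S arbitrary: J f rule: finite_induct)
  case empty
  then have "J \<noteq> {}" by auto
  then show ?case by (intro exI[of _ "\<lambda>_. 1"]) auto
next
  case (insert s S)
  show ?case
  proof (cases "\<forall>j\<in>J. f j s = 0")
    case True
    have "card S < card J" using insert by simp
    with insert.IH[of J f] insert.prems obtain c
      where "\<exists>j\<in>J. c j \<noteq> 0" "\<forall>s\<in>S. (\<Sum>j\<in>J. c j * f j s) = 0"
      by blast
    then show ?thesis using True by (intro exI[of _ c]) auto
  next
    case False
    then obtain p where p: "p \<in> J" "f p s \<noteq> 0" by blast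
    define g where "g j x = f j x - f j s / f p s * f p x" for j x
    have "card S < card (J - {p})" using insert p by simp
    with insert.IH[of "J - {p}" g] insert.prems obtain c
      where c: "\<exists>j\<in>J - {p}. c j \<noteq> 0" "\<forall>x\<in>S. (\<Sum>j\<in>J - {p}. c j * g j x) = 0"
      by blast
    \<comment> \<open>The coefficient of the pivot absorbs the multiples of \<open>f p\<close>
      subtracted in \<open>g\<close>, so that both combinations have the same value.\<close>
    define c' where "c' = c(p := - (\<Sum>j\<in>J - {p}. c j * (f j s / f p s)))"
    have eq: "(\<Sum>j\<in>J. c' j * f j x) = (\<Sum>j\<in>J - {p}. c j * g j x)" for x
    proof -
      have "(\<Sum>j\<in>J. c' j * f j x) = c' p * f p x + (\<Sum>j\<in>J - {p}. c' j * f j x)"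
        using insert.prems p by (simp add: sum.remove)
      also have "(\<Sum>j\<in>J - {p}. c' j * f j x) = (\<Sum>j\<in>J - {p}. c j * f j x)"
        by (intro sum.cong) (auto simp: c'_def)
      finally show ?thesis
        by (simp add: c'_def g_def sum_distrib_right right_diff_distrib sum_subtractf mult.assoc)
    qed
    have "g j s = 0" for j using p by (simp add: g_def)
    then have "\<forall>x\<in>insert s S. (\<Sum>j\<in>J. c' j * f j x) = 0"
      using c(2) by (simp add: eq)
    moreover have "\<exists>j\<in>J. c' j \<noteq> 0" using c(1) by (auto simp: c'_def)
    ultimately show ?thesis by blast
  qed
qed

section \<open>Real symmetric operators and their kernels\<close>

lemma sum_cnj_mult_eq_0_iff:
  assumes "finite (carrier D)" "v \<in> group_alg D"
  shows "(\<Sum>\<gamma>\<in>carrier D. cnj (v \<gamma>) * v \<gamma>) = 0 \<longleftrightarrow> v = (\<lambda>_. 0)"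
proof
  assume "(\<Sum>\<gamma>\<in>carrier D. cnj (v \<gamma>) * v \<gamma>) = 0"
  also have "(\<Sum>\<gamma>\<in>carrier D. cnj (v \<gamma>) * v \<gamma>) = of_real (\<Sum>\<gamma>\<in>carrier D. (norm (v \<gamma>))\<^sup>2)"
    by (simp add: complex_norm_square[symmetric] mult.commute)
  finally have "(\<Sum>\<gamma>\<in>carrier D. (norm (v \<gamma>))\<^sup>2) = 0"
    using of_real_eq_0_iff by blast
  then have "\<forall>\<gamma>\<in>carrier D. v \<gamma> = 0"
    using assms(1) by (simp add: sum_nonneg_eq_0_iff)
  then show "v = (\<lambda>_. 0)"
    using assms(2) by (auto simp: group_alg_def)
qed simp

text \<open>On the orthogonal complement of its kernel, a real symmetric operator is inverted by a
  polynomial in itself. A polynomial, unlike an abstract inverse, visibly commutes with everything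
  that the operator commutes with.\<close>

lemma symmetric_polynomial_inverse:
  fixes D :: "('a, 'b) monoid_scheme"
  assumes fin: "finite (carrier D)" and A: "alg_linear D D A"
    and sym: "\<And>x y. x \<in> group_alg D \<Longrightarrow> y \<in> group_alg D \<Longrightarrow>
      (\<Sum>\<gamma>\<in>carrier D. A x \<gamma> * y \<gamma>) = (\<Sum>\<gamma>\<in>carrier D. x \<gamma> * A y \<gamma>)"
    and real: "\<And>x. x \<in> group_alg D \<Longrightarrow> A (\<lambda>\<gamma>. cnj (x \<gamma>)) = (\<lambda>\<gamma>. cnj (A x \<gamma>))"
  obtains J :: "nat set" and b :: "nat \<Rightarrow> complex" where
    "finite J"
    "\<And>y. y \<in> group_alg D \<Longrightarrow>
       (\<And>z. z \<in> group_alg D \<Longrightarrow> A z = (\<lambda>_. 0) \<Longrightarrow> (\<Sum>\<gamma>\<in>carrier D. z \<gamma> * y \<gamma>) = 0) \<Longrightarrow>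
       A (\<lambda>\<gamma>. \<Sum>j\<in>J. b j * (A ^^ j) y \<gamma>) = y"
proof -
  have cnj_mem: "(\<lambda>\<gamma>. cnj (x \<gamma>)) \<in> group_alg D" if "x \<in> group_alg D" for x
    using that by (simp add: group_alg_def)
  have pow_mem: "(A ^^ j) x \<in> group_alg D" if "x \<in> group_alg D" for x j
    using alg_linear_mem[OF alg_linear_funpow[OF A] that] .
  \<comment> \<open>\<open>A\<close> is self-adjoint for the Hermitian form: the squared norm of
    \<open>A x\<close> is the pairing of the conjugate of \<open>x\<close> with
    \<open>A (A x)\<close>.\<close>
  have ker_sq: "A x = (\<lambda>_. 0)" if x: "x \<in> group_alg D" and "A (A x) = (\<lambda>_. 0)" for x
  proof -
    have "(\<Sum>\<gamma>\<in>carrier D. cnj (A x \<gamma>) * A x \<gamma>) = (\<Sum>\<gamma>\<in>carrier D. cnj (x \<gamma>) * A (A x) \<gamma>)"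
      using sym[OF cnj_mem[OF x] alg_linear_mem[OF A x]] by (simp add: real[OF x])
    also have "\<dots> = 0" using that by simp
    finally show ?thesis
      using sum_cnj_mult_eq_0_iff[OF fin alg_linear_mem[OF A x]] by simp
  qed
  have ker_pow: "A x = (\<lambda>_. 0)" if "x \<in> group_alg D" "(A ^^ m) x = (\<lambda>_. 0)" for x m
    using that(2)
  proof (induction m)
    case 0
    then show ?case using alg_linear_zero[OF A] by simp
  next
    case (Suc m)
    show ?case
    proof (cases m)
      case (Suc k)
      with Suc.prems have "A (A ((A ^^ k) x)) = (\<lambda>_. 0)" by simp
      from ker_sq[OF pow_mem[OF that(1)] this] Suc have "(A ^^ m) x = (\<lambda>_. 0)" by simp
      then show ?thesis by (rule Suc.IH)
    qed (use Suc.prems in simp)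
  qed
  let ?C = "carrier D"
  let ?N = "card (?C \<times> ?C)"
  \<comment> \<open>The powers of \<open>A\<close> with exponents from 0 to \<open>?N\<close> are
    \<open>?N + 1\<close> matrices with \<open>?N\<close> entries each; a pair \<open>p\<close>
    names the basis vector and the coordinate.\<close>
  obtain c :: "nat \<Rightarrow> complex" where c: "\<exists>j\<in>{..?N}. c j \<noteq> 0"
      "\<forall>p\<in>?C \<times> ?C. (\<Sum>j\<le>?N. c j * (A ^^ j) (basis_vec (fst p)) (snd p)) = 0"
    using linear_dependence[of "?C \<times> ?C" "{..?N}" "\<lambda>j p. (A ^^ j) (basis_vec (fst p)) (snd p)"] fin
    by auto
  have rel: "(\<Sum>j\<le>?N. c j * (A ^^ j) y \<delta>) = 0" if y: "y \<in> group_alg D" for y \<delta>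
  proof (cases "\<delta> \<in> ?C")
    case True
    have L: "alg_linear D D (\<lambda>v \<gamma>. \<Sum>j\<le>?N. c j * (A ^^ j) v \<gamma>)"
      by (intro alg_linear_lincomb alg_linear_funpow A)
    show ?thesis
      using fun_cong[OF alg_linear_expand[OF L fin y], of \<delta>] c(2) True by simp
  next
    case False
    then show ?thesis using pow_mem[OF y] by (simp add: group_alg_def)
  qed
  \<comment> \<open>With \<open>m\<close> the lowest exponent that occurs, the relation factors as
    \<open>c m * A^m (1 - A b(A)) = 0\<close>. This dictates the coefficients \<open>b\<close>
    below, and \<open>J\<close> lists the exponents above \<open>m\<close>, shifted down by
    \<open>m + 1\<close>.\<close>
  define m where "m = (LEAST j. c j \<noteq> 0)"
  from c(1) obtain j0 where j0: "j0 \<le> ?N" "c j0 \<noteq> 0" by auto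
  have cm: "c m \<noteq> 0" unfolding m_def by (rule LeastI[of "\<lambda>j. c j \<noteq> 0", OF j0(2)])
  have below: "c j = 0" if "j < m" for j
    using not_less_Least[of j "\<lambda>j. c j \<noteq> 0"] that by (simp add: m_def)
  have "m \<le> j0" using below[of j0] j0(2) by (meson not_le_imp_less)
  with j0(1) have mN: "m \<le> ?N" by simp
  define J where "J = {..<?N - m}"
  define b where "b j = - c (m + Suc j) / c m" for j
  define u where "u y = (\<lambda>\<gamma>. \<Sum>j\<in>J. b j * (A ^^ j) y \<gamma>)" for y
  have u: "alg_linear D D u" unfolding u_def
    by (intro alg_linear_lincomb alg_linear_funpow A)
  have Au: "A (u y) = (\<lambda>\<gamma>. \<Sum>j\<in>J. b j * (A ^^ Suc j) y \<gamma>)" if "y \<in> group_alg D" for y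
    unfolding u_def using alg_linear_sum[OF A, of J "\<lambda>j. (A ^^ j) y" b] pow_mem[OF that]
    by (simp add: J_def)
  \<comment> \<open>This is \<open>(1 - A b(A)) y\<close>, spelled as a two-term combination to
    match \<open>alg_linear_comb\<close>. The factored relation says that \<open>A^m\<close> kills
    it, hence so does \<open>A\<close>.\<close>
  define w where "w y = (\<lambda>\<gamma>. 1 * y \<gamma> + (- 1) * A (u y) \<gamma>)" for y
  have w_mem: "w y \<in> group_alg D" if "y \<in> group_alg D" for y
    using that alg_linear_mem[OF A alg_linear_mem[OF u that]] by (simp add: w_def group_alg_def)
  have Aw: "A (w y) = (\<lambda>_. 0)" if y: "y \<in> group_alg D" for y
  proof (rule ker_pow[OF w_mem[OF y]])
    have "c m * (A ^^ m) (w y) \<delta> = 0" for \<delta>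
    proof -
      have "(A ^^ m) (w y) = (\<lambda>\<gamma>. 1 * (A ^^ m) y \<gamma> + (- 1) * (A ^^ m) (A (u y)) \<gamma>)"
        unfolding w_def
        by (intro alg_linear_comb[OF alg_linear_funpow[OF A]] y alg_linear_mem[OF A]
              alg_linear_mem[OF u])
      moreover have "(A ^^ m) (A (u y)) = (\<lambda>\<gamma>. \<Sum>j\<in>J. b j * (A ^^ (m + Suc j)) y \<gamma>)"
        unfolding Au[OF y] funpow_add o_apply using pow_mem[OF y]
        by (intro alg_linear_sum[OF alg_linear_funpow[OF A]]) (auto simp: J_def simp del: funpow.simps)
      ultimately have "c m * (A ^^ m) (w y) \<delta> =
          c m * (A ^^ m) y \<delta> + (\<Sum>j\<in>J. c (m + Suc j) * (A ^^ (m + Suc j)) y \<delta>)"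
        using cm by (simp add: algebra_simps sum_distrib_left b_def sum_negf del: funpow.simps)
      also have "(\<Sum>j\<in>J. c (m + Suc j) * (A ^^ (m + Suc j)) y \<delta>) =
          (\<Sum>j\<in>{Suc m..?N}. c j * (A ^^ j) y \<delta>)"
        unfolding J_def using mN
        by (intro sum.reindex_bij_witness[of _ "\<lambda>j. j - Suc m" "\<lambda>j. m + Suc j"]) auto
      also have "c m * (A ^^ m) y \<delta> + \<dots> = (\<Sum>j\<in>{m..?N}. c j * (A ^^ j) y \<delta>)"
        using mN by (simp add: sum.atLeast_Suc_atMost)
      also have "\<dots> = (\<Sum>j\<le>?N. c j * (A ^^ j) y \<delta>)"
        using below by (intro sum.mono_neutral_left) auto
      also have "\<dots> = 0" by (rule rel[OF y])
      finally show ?thesis .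
    qed
    then show "(A ^^ m) (w y) = (\<lambda>_. 0)" using cm by auto
  qed
  have "A (u y) = y" if y: "y \<in> group_alg D"
    and perp: "\<And>z. z \<in> group_alg D \<Longrightarrow> A z = (\<lambda>_. 0) \<Longrightarrow> (\<Sum>\<gamma>\<in>?C. z \<gamma> * y \<gamma>) = 0" for y
  proof -
    \<comment> \<open>\<open>w y\<close> lies both in the kernel and in its orthogonal complement.\<close>
    let ?z = "\<lambda>\<gamma>. cnj (w y \<gamma>)"
    have z: "?z \<in> group_alg D" "A ?z = (\<lambda>_. 0)"
      using cnj_mem[OF w_mem[OF y]] real[OF w_mem[OF y]] Aw[OF y] by simp_all
    have "(\<Sum>\<gamma>\<in>?C. ?z \<gamma> * w y \<gamma>) = (\<Sum>\<gamma>\<in>?C. ?z \<gamma> * y \<gamma>) - (\<Sum>\<gamma>\<in>?C. ?z \<gamma> * A (u y) \<gamma>)"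
      by (simp add: w_def algebra_simps sum_subtractf sum.distrib)
    also have "(\<Sum>\<gamma>\<in>?C. ?z \<gamma> * y \<gamma>) = 0" by (rule perp[OF z])
    also have "(\<Sum>\<gamma>\<in>?C. ?z \<gamma> * A (u y) \<gamma>) = (\<Sum>\<gamma>\<in>?C. A ?z \<gamma> * u y \<gamma>)"
      by (rule sym[OF z(1) alg_linear_mem[OF u y], symmetric])
    finally have "w y = (\<lambda>_. 0)"
      using sum_cnj_mult_eq_0_iff[OF fin w_mem[OF y]] z(2) by simp
    then show ?thesis by (auto simp: w_def fun_eq_iff)
  qed
  then show ?thesis
    using that[of J b] by (simp add: J_def u_def)
qed

section \<open>Characters\<close>

lemma qz_ee_zero: "qz_ee 0 = 1"
  by transfer (simp add: ee_def)

lemma qz_ee_add: "qz_ee (x + y) = qz_ee x * qz_ee y"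
  by transfer (simp add: ee_def of_rat_add distrib_left exp_add)

text \<open>Faithfulness of the exponential on the rationals modulo 1: a nonzero value of the
  bilinear form yields a nontrivial character value.\<close>

lemma qz_ee_eq_1_iff: "qz_ee x = 1 \<longleftrightarrow> x = 0"
proof transfer
  fix x :: rat
  have "ee (of_rat x) = 1 \<longleftrightarrow> (\<exists>n::int. of_rat x = (of_int n :: real))"
  proof -
    have "(of_rat x :: complex) = of_real (of_rat x)"
      by (cases x) (simp add: Fract_of_int_quotient of_rat_divide)
    then have "ee (of_rat x) = exp (2 * of_real pi * \<i> * of_real (of_rat x))"
      by (simp add: ee_def)
    then show ?thesis by (simp add: exp_eq_1)
  qed
  also have "\<dots> \<longleftrightarrow> (\<exists>n::int. x = of_int n)"
    by (metis of_rat_eq_iff of_rat_of_int_eq)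
  finally show "ee (of_rat x) = 1 \<longleftrightarrow> qz_rel x 0"
    by (auto simp: qz_rel_def elim: Ints_cases)
qed

locale disc_form =
  fixes D :: "('a, 'b) monoid_scheme" (structure) and Q :: "'a \<Rightarrow> qz"
  assumes disc: "discriminant_form D Q"
begin

sublocale comm_group D
  using disc by (simp add: discriminant_form_def)

lemma finite_carrier: "finite (carrier D)"
  using disc by (simp add: discriminant_form_def)

lemma bil_mult_right:
  "x \<in> carrier D \<Longrightarrow> y \<in> carrier D \<Longrightarrow> z \<in> carrier D \<Longrightarrow>
   bil D Q x (y \<otimes> z) = bil D Q x y + bil D Q x z"
  using disc by (simp add: discriminant_form_def)

lemma bil_commute: "x \<in> carrier D \<Longrightarrow> y \<in> carrier D \<Longrightarrow> bil D Q x y = bil D Q y x"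
  by (simp add: bil_def m_comm)

lemma bil_mult_left:
  "x \<in> carrier D \<Longrightarrow> y \<in> carrier D \<Longrightarrow> z \<in> carrier D \<Longrightarrow>
   bil D Q (x \<otimes> y) z = bil D Q x z + bil D Q y z"
  using disc by (simp add: discriminant_form_def)

lemma bil_one_left: "x \<in> carrier D \<Longrightarrow> bil D Q \<one> x = 0"
  using bil_mult_left[of \<one> \<one> x] by simp

lemma bil_nondegenerate:
  "x \<in> carrier D \<Longrightarrow> (\<And>y. y \<in> carrier D \<Longrightarrow> bil D Q x y = 0) \<Longrightarrow> x = \<one>"
  using disc by (simp add: discriminant_form_def)

lemma bil_inv_left:
  assumes "x \<in> carrier D" "y \<in> carrier D"
  shows "bil D Q (inv x) y = - bil D Q x y"
  using bil_mult_left[of "inv x" x y] assms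
  by (simp add: bil_one_left eq_neg_iff_add_eq_0)

text \<open>If the character takes a value other than 1 at some \<open>k\<close> in
  \<open>K\<close>, translating the summation variable by \<open>k\<close> multiplies the sum by
  that value, so the sum vanishes.\<close>

lemma character_sum:
  assumes K: "subgroup K D" and g: "g \<in> carrier D"
  shows "(\<Sum>x\<in>K. qz_ee (bil D Q g x)) = (if \<forall>x\<in>K. bil D Q g x = 0 then of_nat (card K) else 0)"
proof (cases "\<forall>x\<in>K. bil D Q g x = 0")
  case True
  then show ?thesis by (simp add: qz_ee_zero)
next
  case False
  then obtain k where k: "k \<in> K" "bil D Q g k \<noteq> 0" by blast
  note mem = subgroup.mem_carrier[OF K]
  have "bij_betw (\<lambda>x. k \<otimes> x) K K"
  proof (rule bij_betw_byWitness[where f' = "\<lambda>x. inv k \<otimes> x"])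
    show "\<forall>x\<in>K. inv k \<otimes> (k \<otimes> x) = x" "\<forall>x\<in>K. k \<otimes> (inv k \<otimes> x) = x"
      using k(1) mem by (simp_all add: m_assoc[symmetric])
    show "(\<lambda>x. k \<otimes> x) ` K \<subseteq> K" "(\<lambda>x. inv k \<otimes> x) ` K \<subseteq> K"
      using k(1) K by (auto intro: subgroup.m_closed subgroup.m_inv_closed)
  qed
  then have "(\<Sum>x\<in>K. qz_ee (bil D Q g x)) = (\<Sum>x\<in>K. qz_ee (bil D Q g (k \<otimes> x)))"
    by (rule sum.reindex_bij_betw[symmetric])
  also have "\<dots> = qz_ee (bil D Q g k) * (\<Sum>x\<in>K. qz_ee (bil D Q g x))"
    using k(1) mem g by (simp add: bil_mult_right qz_ee_add sum_distrib_left)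
  finally have "(\<Sum>x\<in>K. qz_ee (bil D Q g x)) = 0"
    using k(2) qz_ee_eq_1_iff by simp
  then show ?thesis by (simp only: if_not_P[OF False])
qed

end

section \<open>Isotropic subgroups and their quotients\<close>

locale isotropic = disc_form +
  fixes H
  assumes iso: "isotropic_subgroup D Q H"
begin

abbreviation perp where "perp \<equiv> orth D Q H"

abbreviation quot where "quot \<equiv> quot_group D Q H"

lemma subgroup_H: "subgroup H D" and Q_H: "h \<in> H \<Longrightarrow> Q h = 0"
  using iso by (simp_all add: isotropic_subgroup_def)

lemma H_carrier: "h \<in> H \<Longrightarrow> h \<in> carrier D"
  using subgroup.mem_carrier[OF subgroup_H] .

lemma finite_H: "finite H"
  using finite_carrier H_carrier by (meson finite_subset subsetI)

lemma card_H_pos: "card H > 0"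
  using finite_H subgroup.one_closed[OF subgroup_H] card_gt_0_iff by blast

lemma perp_carrier: "x \<in> perp \<Longrightarrow> x \<in> carrier D"
  by (simp add: orth_def)

lemma finite_perp: "finite perp"
  using finite_carrier by (simp add: orth_def)

lemma bil_perp: "x \<in> perp \<Longrightarrow> h \<in> H \<Longrightarrow> bil D Q x h = 0"
  by (simp add: orth_def)

lemma bil_perp': "x \<in> perp \<Longrightarrow> h \<in> H \<Longrightarrow> bil D Q h x = 0"
  using bil_perp bil_commute H_carrier perp_carrier by metis

lemma H_perp: "h \<in> H \<Longrightarrow> h \<in> perp"
  using subgroup.m_closed[OF subgroup_H] H_carrier Q_H by (simp add: orth_def bil_def)

lemma subgroup_perp: "subgroup perp D"
proof
  show "perp \<subseteq> carrier D" using perp_carrier by auto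
  show "\<one> \<in> perp" using H_perp subgroup.one_closed[OF subgroup_H] by simp
  show "x \<otimes> y \<in> perp" if "x \<in> perp" "y \<in> perp" for x y
    using that H_carrier by (simp add: orth_def bil_mult_left)
  show "inv x \<in> perp" if "x \<in> perp" for x
    using that H_carrier by (simp add: orth_def bil_inv_left)
qed

lemma H_mult_perp: "h \<in> H \<Longrightarrow> x \<in> perp \<Longrightarrow> h \<otimes> x \<in> perp"
  using subgroup.m_closed[OF subgroup_perp] H_perp by blast

lemma Q_H_mult: "h \<in> H \<Longrightarrow> x \<in> perp \<Longrightarrow> Q (h \<otimes> x) = Q x"
  using bil_perp'[of x h] Q_H by (simp add: bil_def)

lemma coset_eq_image: "H #> x = (\<lambda>h. h \<otimes> x) ` H"
  by (auto simp: r_coset_def)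

lemma inj_coset: "x \<in> carrier D \<Longrightarrow> inj_on (\<lambda>h. h \<otimes> x) H"
  using H_carrier by (auto simp: inj_on_def)

lemma card_coset: "x \<in> carrier D \<Longrightarrow> card (H #> x) = card H"
  using inj_coset by (simp add: coset_eq_image card_image)

lemma sum_coset: "x \<in> carrier D \<Longrightarrow> sum f (H #> x) = (\<Sum>h\<in>H. f (h \<otimes> x))"
  using inj_coset by (simp add: coset_eq_image sum.reindex)

lemma coset_perp: "x \<in> perp \<Longrightarrow> y \<in> H #> x \<Longrightarrow> y \<in> perp"
  using H_mult_perp by (auto simp: coset_eq_image)

lemma coset_eq_iff: "x \<in> carrier D \<Longrightarrow> y \<in> carrier D \<Longrightarrow> H #> x = H #> y \<longleftrightarrow> x \<in> H #> y"
  using repr_independence[OF _ _ subgroup_H] rcos_self[OF _ subgroup_H] by metis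

lemma coset_H_mult: "h \<in> H \<Longrightarrow> x \<in> carrier D \<Longrightarrow> H #> (h \<otimes> x) = H #> x"
  using coset_eq_iff[of "h \<otimes> x" x] H_carrier by (auto simp: coset_eq_image)

lemma coset_fibre: "x \<in> perp \<Longrightarrow> {y \<in> perp. H #> y = H #> x} = H #> x"
  using coset_eq_iff perp_carrier coset_perp by blast

lemma carrier_quot: "carrier quot = (\<lambda>x. H #> x) ` perp"
  by (auto simp: quot_group_def FactGroup_def RCOSETS_def r_coset_def)

lemma finite_quot: "finite (carrier quot)"
  using finite_perp by (simp add: carrier_quot)

lemma coset_quot: "x \<in> perp \<Longrightarrow> H #> x \<in> carrier quot"
  by (simp add: carrier_quot)

lemma mult_quot:
  assumes "x \<in> perp" "y \<in> perp"
  shows "(H #> x) \<otimes>\<^bsub>quot\<^esub> (H #> y) = H #> (x \<otimes> y)"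
proof -
  have "(H #> x) <#> (H #> y) = H #> (x \<otimes> y)"
    using normal.rcos_sum[OF subgroup_imp_normal[OF subgroup_H]] assms perp_carrier by simp
  then show ?thesis
    by (simp add: quot_group_def FactGroup_def set_mult_def)
qed

lemma sum_perp: "(\<Sum>x\<in>perp. f x) = (\<Sum>\<alpha>\<in>carrier quot. \<Sum>x\<in>\<alpha>. f x)"
proof -
  have "(\<Sum>x\<in>perp. f x) = (\<Sum>\<alpha>\<in>carrier quot. \<Sum>x\<in>{y \<in> perp. H #> y = \<alpha>}. f x)"
    unfolding carrier_quot by (rule sum.image_gen[OF finite_perp])
  also have "\<dots> = (\<Sum>\<alpha>\<in>carrier quot. \<Sum>x\<in>\<alpha>. f x)"
    by (rule sum.cong) (auto simp: carrier_quot coset_fibre)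
  finally show ?thesis .
qed

lemma quot_form_coset:
  assumes "x \<in> perp"
  shows "quot_form Q (H #> x) = Q x"
proof -
  have "Q ` (H #> x) = {Q x}"
    using assms Q_H_mult subgroup.one_closed[OF subgroup_H] by (auto simp: coset_eq_image image_iff)
  then show ?thesis by (simp add: quot_form_def)
qed

lemma bil_quot:
  "x \<in> perp \<Longrightarrow> y \<in> perp \<Longrightarrow> bil quot (quot_form Q) (H #> x) (H #> y) = bil D Q x y"
  using subgroup.m_closed[OF subgroup_perp]
  by (simp add: bil_def mult_quot quot_form_coset)

section \<open>Orders of the isotropic subgroup, its complement and the quotient\<close>

lemma card_perp: "card perp = card H * card (carrier quot)"
proof -
  have "card perp = (\<Sum>\<alpha>\<in>carrier quot. card \<alpha>)"
    using sum_perp[of "\<lambda>_. 1::nat"] by simp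
  also have "\<dots> = (\<Sum>\<alpha>\<in>carrier quot. card H)"
    by (rule sum.cong) (auto simp: carrier_quot card_coset perp_carrier)
  finally show ?thesis by simp
qed

lemma character_sum_H:
  "g \<in> carrier D \<Longrightarrow> (\<Sum>h\<in>H. qz_ee (bil D Q g h)) = (if g \<in> perp then of_nat (card H) else 0)"
  using character_sum[OF subgroup_H] by (simp add: orth_def)

text \<open>Double counting of \<open>?s\<close>: summing over \<open>H\<close> first leaves the
  elements of \<open>perp\<close>, each with weight \<open>card H\<close>; summing over the whole
  group first leaves only the neutral element, by nondegeneracy.\<close>

lemma card_carrier_perp: "card (carrier D) = card H * card perp"
proof -
  let ?s = "\<Sum>g\<in>carrier D. \<Sum>h\<in>H. qz_ee (bil D Q g h)"
  have "?s = (\<Sum>g\<in>carrier D. if g \<in> perp then of_nat (card H) else 0)"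
    by (simp add: character_sum_H)
  also have "\<dots> = (\<Sum>g\<in>perp. of_nat (card H))"
    using finite_carrier perp_carrier
    by (simp add: sum.If_cases Int_absorb1 subset_iff)
  finally have 1: "?s = of_nat (card perp * card H)" by simp
  have "?s = (\<Sum>h\<in>H. \<Sum>g\<in>carrier D. qz_ee (bil D Q h g))"
    by (subst sum.swap) (simp add: bil_commute H_carrier)
  also have "\<dots> = (\<Sum>h\<in>H. if h = \<one> then of_nat (card (carrier D)) else 0)"
  proof (rule sum.cong[OF refl])
    fix h assume "h \<in> H"
    then have "(\<forall>x\<in>carrier D. bil D Q h x = 0) \<longleftrightarrow> h = \<one>"
      using bil_nondegenerate bil_one_left H_carrier by metis
    then show "(\<Sum>g\<in>carrier D. qz_ee (bil D Q h g)) = (if h = \<one> then of_nat (card (carrier D)) else 0)"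
      using character_sum[OF subgroup_self H_carrier[OF \<open>h \<in> H\<close>]] by simp
  qed
  also have "\<dots> = of_nat (card (carrier D))"
    using finite_H subgroup.one_closed[OF subgroup_H] by simp
  finally have "of_nat (card (carrier D)) = (of_nat (card perp * card H) :: complex)"
    using 1 by simp
  then show ?thesis by (metis of_nat_eq_iff mult.commute)
qed

lemma card_carrier_quot: "card (carrier D) = (card H)\<^sup>2 * card (carrier quot)"
  by (simp add: card_carrier_perp card_perp power2_eq_square)

text \<open>Compares the normalising constants of the Gauss sums and of S on both sides.\<close>

lemma sqrt_card_quot:
  "sqrt (real (card (carrier D))) = real (card H) * sqrt (real (card (carrier quot)))"
  by (simp add: card_carrier_quot real_sqrt_mult)

end

section \<open>Arrow operators and the Weil representation\<close>

text \<open>\<open>up\<close> acts on functions of \<tau>; this is the linear map it applies at each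
  \<tau>, with the sum over basis vectors evaluated.\<close>

definition up_vec :: "('a, 'b) monoid_scheme \<Rightarrow> ('a \<Rightarrow> qz) \<Rightarrow> 'a set \<Rightarrow> ('a set \<Rightarrow> complex) \<Rightarrow> 'a \<Rightarrow> complex"
where
  "up_vec D Q H w = (\<lambda>\<gamma>. if \<gamma> \<in> orth D Q H then w (H #>\<^bsub>D\<^esub> \<gamma>) else 0)"

context disc_form
begin

lemma weil_alg_linear: "weil_representation D Q \<rho> \<Longrightarrow> M \<in> SL2Z \<Longrightarrow> alg_linear D D (\<rho> M)"
  by (simp add: weil_representation_def alg_linear_def)

lemma weil_matT:
  assumes \<rho>: "weil_representation D Q \<rho>" and v: "v \<in> group_alg D"
  shows "\<rho> matT v = (\<lambda>\<delta>. qz_ee (Q \<delta>) * v \<delta>)"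
proof -
  have T: "\<rho> matT (basis_vec \<gamma>) = (\<lambda>\<delta>. qz_ee (Q \<gamma>) * basis_vec \<gamma> \<delta>)" if "\<gamma> \<in> carrier D" for \<gamma>
    using \<rho> that by (simp add: weil_representation_def)
  have "\<rho> matT v = (\<lambda>\<delta>. \<Sum>\<gamma>\<in>carrier D. v \<gamma> * (qz_ee (Q \<gamma>) * basis_vec \<gamma> \<delta>))"
    using alg_linear_expand[OF weil_alg_linear[OF \<rho> matT_in_SL2Z] finite_carrier v] T by simp
  also have "\<dots> = (\<lambda>\<delta>. \<Sum>\<gamma>\<in>carrier D. if \<delta> = \<gamma> then qz_ee (Q \<delta>) * v \<delta> else 0)"
    by (intro ext sum.cong) (auto simp: basis_vec_def)
  also have "\<dots> = (\<lambda>\<delta>. qz_ee (Q \<delta>) * v \<delta>)"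
    using v finite_carrier by (auto simp: group_alg_def)
  finally show ?thesis .
qed

definition weil_const :: complex where
  "weil_const = ee (- of_int (disc_sign D Q) / 8) / of_real (sqrt (real (card (carrier D))))"

lemma weil_matS:
  assumes \<rho>: "weil_representation D Q \<rho>" and v: "v \<in> group_alg D"
  shows "\<rho> matS v = (\<lambda>\<delta>. if \<delta> \<in> carrier D
    then weil_const * (\<Sum>\<gamma>\<in>carrier D. qz_ee (- bil D Q \<gamma> \<delta>) * v \<gamma>) else 0)"
proof -
  have S: "\<rho> matS (basis_vec \<gamma>) =
      (\<lambda>\<delta>. if \<delta> \<in> carrier D then weil_const * qz_ee (- bil D Q \<gamma> \<delta>) else 0)"
    if "\<gamma> \<in> carrier D" for \<gamma>
  proof -
    have "(\<Sum>\<beta>\<in>carrier D. qz_ee (- bil D Q \<gamma> \<beta>) * basis_vec \<beta> \<delta>) =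
        (\<Sum>\<beta>\<in>carrier D. if \<delta> = \<beta> then qz_ee (- bil D Q \<gamma> \<delta>) else 0)" for \<delta>
      by (intro sum.cong) (auto simp: basis_vec_def)
    then have "(\<Sum>\<beta>\<in>carrier D. qz_ee (- bil D Q \<gamma> \<beta>) * basis_vec \<beta> \<delta>) =
        (if \<delta> \<in> carrier D then qz_ee (- bil D Q \<gamma> \<delta>) else 0)" for \<delta>
      using finite_carrier by simp
    then show ?thesis
      using \<rho> that by (auto simp: weil_representation_def weil_const_def)
  qed
  have "\<rho> matS v = (\<lambda>\<delta>. \<Sum>\<gamma>\<in>carrier D. v \<gamma> *
      (if \<delta> \<in> carrier D then weil_const * qz_ee (- bil D Q \<gamma> \<delta>) else 0))"
    using alg_linear_expand[OF weil_alg_linear[OF \<rho> matS_in_SL2Z] finite_carrier v] S by simp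
  then show ?thesis
    by (auto simp: fun_eq_iff sum_distrib_left intro!: sum.cong)
qed

end

context isotropic
begin

abbreviation dn where "dn \<equiv> down D Q H"

abbreviation upv where "upv \<equiv> up_vec D Q H"

lemma up_eq_up_vec: "up D Q H G \<tau> = upv (G \<tau>)"
proof
  fix \<delta>
  have "up D Q H G \<tau> \<delta> = (\<Sum>\<gamma>\<in>perp. if \<delta> = \<gamma> then G \<tau> (H #> \<delta>) else 0)"
    unfolding up_def by (intro sum.cong) (auto simp: basis_vec_def)
  then show "up D Q H G \<tau> \<delta> = upv (G \<tau>) \<delta>"
    using finite_perp by (simp add: up_vec_def)
qed

lemma down_eq: "dn v \<alpha> = (\<Sum>\<gamma>\<in>{\<gamma>\<in>perp. H #> \<gamma> = \<alpha>}. v \<gamma>)"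
proof -
  have "dn v \<alpha> = (\<Sum>\<gamma>\<in>perp. if H #> \<gamma> = \<alpha> then v \<gamma> else 0)"
    unfolding down_def by (intro sum.cong) (auto simp: basis_vec_def)
  then show ?thesis
    using finite_perp by (simp add: sum.inter_filter)
qed

lemma down_coset: "x \<in> perp \<Longrightarrow> dn v (H #> x) = (\<Sum>h\<in>H. v (h \<otimes> x))"
  by (simp add: down_eq coset_fibre sum_coset perp_carrier)

lemma down_mem: "dn v \<in> group_alg quot"
proof -
  have "dn v \<alpha> = 0" if "\<alpha> \<notin> carrier quot" for \<alpha>
    unfolding down_eq using that by (intro sum.neutral) (auto simp: carrier_quot)
  then show ?thesis by (simp add: group_alg_def)
qed

lemma down_alg_linear: "alg_linear D quot dn"
  by (simp add: alg_linear_def down_mem)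
    (simp add: down_eq fun_eq_iff sum.distrib sum_distrib_left)

lemma up_vec_alg_linear: "alg_linear quot D upv"
  using perp_carrier by (auto simp: alg_linear_def up_vec_def group_alg_def)

lemma quot_alg_eqI:
  assumes "v \<in> group_alg quot" "w \<in> group_alg quot" "\<And>x. x \<in> perp \<Longrightarrow> v (H #> x) = w (H #> x)"
  shows "v = w"
proof
  fix \<alpha>
  show "v \<alpha> = w \<alpha>"
  proof (cases "\<alpha> \<in> carrier quot")
    case True
    then show ?thesis using assms(3) by (auto simp: carrier_quot)
  next
    case False
    then show ?thesis using assms(1,2) by (simp add: group_alg_def)
  qed
qed

text \<open>Every coset in \<open>perp\<close> has \<open>card H\<close> elements, on which the
  lifted vector is constant.\<close>

lemma down_up_vec:
  assumes "w \<in> group_alg quot"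
  shows "dn (upv w) = (\<lambda>\<alpha>. of_nat (card H) * w \<alpha>)"
proof (rule quot_alg_eqI[OF down_mem])
  show "(\<lambda>\<alpha>. of_nat (card H) * w \<alpha>) \<in> group_alg quot"
    using assms by (simp add: group_alg_def)
  show "dn (upv w) (H #> x) = of_nat (card H) * w (H #> x)" if "x \<in> perp" for x
    using that by (simp add: down_coset up_vec_def H_mult_perp coset_H_mult perp_carrier)
qed

text \<open>Only \<open>perp\<close> contributes on the left, and grouping it by cosets gives the
  right side. This turns membership in the kernel of \<open>down\<close> into orthogonality to the
  image of \<open>up\<close>.\<close>

lemma up_down_adjoint:
  "(\<Sum>\<gamma>\<in>carrier D. x \<gamma> * upv w \<gamma>) = (\<Sum>\<alpha>\<in>carrier quot. dn x \<alpha> * w \<alpha>)"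
proof -
  have "(\<Sum>\<gamma>\<in>carrier D. x \<gamma> * upv w \<gamma>) = (\<Sum>\<gamma>\<in>perp. x \<gamma> * w (H #> \<gamma>))"
    using finite_carrier perp_carrier
    by (intro sum.mono_neutral_cong_right) (auto simp: up_vec_def)
  also have "\<dots> = (\<Sum>\<alpha>\<in>carrier quot. \<Sum>\<gamma>\<in>{\<gamma> \<in> perp. H #> \<gamma> = \<alpha>}. x \<gamma> * w (H #> \<gamma>))"
    unfolding carrier_quot by (rule sum.image_gen[OF finite_perp])
  also have "\<dots> = (\<Sum>\<alpha>\<in>carrier quot. dn x \<alpha> * w \<alpha>)"
    by (simp add: down_eq sum_distrib_right)
  finally show ?thesis .
qed

lemma character_sum_H_neg:
  assumes g: "g \<in> carrier D"
  shows "(\<Sum>h\<in>H. qz_ee (- bil D Q g h)) = (if g \<in> perp then of_nat (card H) else 0)"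
proof -
  have "inv g \<in> perp \<longleftrightarrow> g \<in> perp"
    using subgroup.m_inv_closed[OF subgroup_perp] g by (metis inv_inv)
  moreover have "(\<Sum>h\<in>H. qz_ee (- bil D Q g h)) = (\<Sum>h\<in>H. qz_ee (bil D Q (inv g) h))"
    using g H_carrier by (simp add: bil_inv_left)
  ultimately show ?thesis
    using character_sum_H[of "inv g"] g by simp
qed

text \<open>T acts diagonally, with eigenvalues that are constant on the cosets of \<open>H\<close>
  inside \<open>perp\<close>.\<close>

lemma up_down_matT:
  assumes \<rho>: "weil_representation D Q \<rho>" and v: "v \<in> group_alg D"
  shows "\<rho> matT (upv (dn v)) = upv (dn (\<rho> matT v))"
  unfolding weil_matT[OF \<rho> v]
    weil_matT[OF \<rho> alg_linear_mem[OF up_vec_alg_linear down_mem]]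
  by (auto simp: up_vec_def down_coset Q_H_mult sum_distrib_left)

text \<open>For \<delta> in \<open>perp\<close> both sides are \<open>weil_const * card H\<close>
  times the sum of \<open>qz_ee (- bil D Q \<gamma> \<delta>) * v \<gamma>\<close> over \<gamma> in
  \<open>perp\<close>; for other \<delta> both vanish. On the left, a character sum over
  \<open>H\<close> forces \<delta> into \<open>perp\<close>; on the right, summing over the coset of
  \<delta> forces \<gamma> into \<open>perp\<close>.\<close>

lemma up_down_matS:
  assumes \<rho>: "weil_representation D Q \<rho>" and v: "v \<in> group_alg D"
  shows "\<rho> matS (upv (dn v)) = upv (dn (\<rho> matS v))"
proof
  fix \<delta>
  let ?s = "\<Sum>\<gamma>\<in>carrier D. if \<gamma> \<in> perp then of_nat (card H) * qz_ee (- bil D Q \<gamma> \<delta>) * v \<gamma> else 0"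
  show "\<rho> matS (upv (dn v)) \<delta> = upv (dn (\<rho> matS v)) \<delta>"
  proof (cases "\<delta> \<in> carrier D")
    case \<delta>: True
    define x where "x = (\<lambda>\<gamma>. qz_ee (- bil D Q \<gamma> \<delta>))"
    have "\<rho> matS (upv (dn v)) \<delta> = weil_const * (\<Sum>\<gamma>\<in>carrier D. x \<gamma> * upv (dn v) \<gamma>)"
      unfolding weil_matS[OF \<rho> alg_linear_mem[OF up_vec_alg_linear down_mem]]
      using \<delta> by (simp add: x_def)
    \<comment> \<open>Up after down is symmetric: transposing on either side gives the pairing of
      \<open>dn x\<close> with \<open>dn v\<close>. The averaging thus moves from \<open>v\<close>
      to the explicit character \<open>x\<close>.\<close>
    also have "(\<Sum>\<gamma>\<in>carrier D. x \<gamma> * upv (dn v) \<gamma>) = (\<Sum>\<gamma>\<in>carrier D. v \<gamma> * upv (dn x) \<gamma>)"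
      unfolding up_down_adjoint by (simp add: mult.commute)
    also have "\<dots> = (if \<delta> \<in> perp then ?s else 0)"
    proof -
      have "upv (dn x) \<gamma> = (if \<gamma> \<in> perp \<and> \<delta> \<in> perp then of_nat (card H) * x \<gamma> else 0)" for \<gamma>
      proof (cases "\<gamma> \<in> perp")
        case True
        have "qz_ee (- bil D Q (h \<otimes> \<gamma>) \<delta>) = qz_ee (- bil D Q \<delta> h) * x \<gamma>" if "h \<in> H" for h
        proof -
          have "- bil D Q (h \<otimes> \<gamma>) \<delta> = - bil D Q \<delta> h + - bil D Q \<gamma> \<delta>"
            using True that \<delta> bil_commute[of \<delta> h]
            by (simp add: bil_mult_left H_carrier perp_carrier)
          then show ?thesis by (simp only: qz_ee_add x_def)
        qed
        then have "(\<Sum>h\<in>H. x (h \<otimes> \<gamma>)) = (\<Sum>h\<in>H. qz_ee (- bil D Q \<delta> h)) * x \<gamma>"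
          by (simp add: x_def sum_distrib_right)
        then show ?thesis
          using True \<delta> by (simp add: up_vec_def down_coset character_sum_H_neg)
      qed (simp add: up_vec_def)
      then show ?thesis
        by (auto simp: x_def intro!: sum.cong sum.neutral)
    qed
    also have "weil_const * \<dots> = upv (dn (\<rho> matS v)) \<delta>"
    proof (cases "\<delta> \<in> perp")
      case True
      have "upv (dn (\<rho> matS v)) \<delta> = (\<Sum>h\<in>H. \<rho> matS v (h \<otimes> \<delta>))"
        using True by (simp add: up_vec_def down_coset)
      also have "\<dots> = (\<Sum>h\<in>H. weil_const * (\<Sum>\<gamma>\<in>carrier D. qz_ee (- bil D Q \<gamma> (h \<otimes> \<delta>)) * v \<gamma>))"
        using \<delta> H_carrier by (simp add: weil_matS[OF \<rho> v])
      also have "\<dots> = weil_const * (\<Sum>\<gamma>\<in>carrier D. \<Sum>h\<in>H. qz_ee (- bil D Q \<gamma> (h \<otimes> \<delta>)) * v \<gamma>)"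
        by (subst sum.swap) (simp add: sum_distrib_left)
      also have "(\<Sum>\<gamma>\<in>carrier D. \<Sum>h\<in>H. qz_ee (- bil D Q \<gamma> (h \<otimes> \<delta>)) * v \<gamma>) = ?s"
      proof (rule sum.cong[OF refl])
        fix \<gamma> assume \<gamma>: "\<gamma> \<in> carrier D"
        have "qz_ee (- bil D Q \<gamma> (h \<otimes> \<delta>)) = qz_ee (- bil D Q \<gamma> h) * qz_ee (- bil D Q \<gamma> \<delta>)"
          if "h \<in> H" for h
        proof -
          have "- bil D Q \<gamma> (h \<otimes> \<delta>) = - bil D Q \<gamma> h + - bil D Q \<gamma> \<delta>"
            using \<gamma> that \<delta> by (simp add: bil_mult_right H_carrier)
          then show ?thesis by (simp only: qz_ee_add)
        qed
        then have "(\<Sum>h\<in>H. qz_ee (- bil D Q \<gamma> (h \<otimes> \<delta>)) * v \<gamma>) =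
            (\<Sum>h\<in>H. qz_ee (- bil D Q \<gamma> h)) * (qz_ee (- bil D Q \<gamma> \<delta>) * v \<gamma>)"
          by (simp add: sum_distrib_right mult.assoc)
        then show "(\<Sum>h\<in>H. qz_ee (- bil D Q \<gamma> (h \<otimes> \<delta>)) * v \<gamma>) =
            (if \<gamma> \<in> perp then of_nat (card H) * qz_ee (- bil D Q \<gamma> \<delta>) * v \<gamma> else 0)"
          using \<gamma> by (simp add: character_sum_H_neg)
      qed
      finally show ?thesis using True by simp
    qed (simp add: up_vec_def)
    finally show ?thesis .
  next
    case False
    then show ?thesis
      using perp_carrier weil_matS[OF \<rho> alg_linear_mem[OF up_vec_alg_linear down_mem], of v]
      by (auto simp: up_vec_def[of _ _ _ "dn (\<rho> matS v)"])
  qed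
qed

text \<open>Commuting with up after down passes to products, so the cases S and T suffice.\<close>

lemma up_down_weil:
  assumes \<rho>: "weil_representation D Q \<rho>" and "M \<in> SL2Z" "v \<in> group_alg D"
  shows "\<rho> M (upv (dn v)) = upv (dn (\<rho> M v))"
proof -
  have mem: "upv (dn v) \<in> group_alg D" for v
    by (intro alg_linear_mem[OF up_vec_alg_linear] down_mem)
  have mult: "\<rho> (M ** N) v = \<rho> M (\<rho> N v)" if "M \<in> SL2Z" "N \<in> SL2Z" "v \<in> group_alg D" for M N v
    using \<rho> that by (simp add: weil_representation_def)
  have one: "\<rho> (mat 1) v = v" if "v \<in> group_alg D" for v
    using \<rho> that by (simp add: weil_representation_def)
  have "\<forall>v\<in>group_alg D. \<rho> M (upv (dn v)) = upv (dn (\<rho> M v))"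
  proof (rule SL2Z_induct[OF assms(2)])
    show "\<forall>v\<in>group_alg D. \<rho> (mat 1) (upv (dn v)) = upv (dn (\<rho> (mat 1) v))"
      by (simp add: one mem)
  next
    fix M
    assume "M \<in> SL2Z" "\<forall>v\<in>group_alg D. \<rho> M (upv (dn v)) = upv (dn (\<rho> M v))"
    then show "\<forall>v\<in>group_alg D. \<rho> (matS ** M) (upv (dn v)) = upv (dn (\<rho> (matS ** M) v))"
      using alg_linear_mem[OF weil_alg_linear[OF \<rho>]]
      by (simp add: mult matS_in_SL2Z mem up_down_matS[OF \<rho>])
  next
    fix M
    assume "M \<in> SL2Z" "\<forall>v\<in>group_alg D. \<rho> M (upv (dn v)) = upv (dn (\<rho> M v))"
    then show "\<forall>v\<in>group_alg D. \<rho> (matT ** M) (upv (dn v)) = upv (dn (\<rho> (matT ** M) v))"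
      using alg_linear_mem[OF weil_alg_linear[OF \<rho>]]
      by (simp add: mult matT_in_SL2Z mem up_down_matT[OF \<rho>])
  qed
  with assms(3) show ?thesis by simp
qed

section \<open>Signature and Weil representation of the quotient\<close>

text \<open>Translating by \<open>h\<close> in \<open>H\<close> multiplies the summand at \<gamma>
  by \<open>qz_ee (bil D Q \<gamma> h)\<close>. Averaging over \<open>H\<close> removes every
  \<gamma> outside \<open>perp\<close>, and on \<open>perp\<close> the summand depends only on the
  coset.\<close>

lemma gauss_sum_quot:
  "(\<Sum>\<gamma>\<in>carrier D. qz_ee (Q \<gamma>)) = of_nat (card H) * (\<Sum>\<alpha>\<in>carrier quot. qz_ee (quot_form Q \<alpha>))"
proof -
  have shift: "(\<Sum>\<gamma>\<in>carrier D. qz_ee (Q \<gamma>)) = (\<Sum>\<gamma>\<in>carrier D. qz_ee (Q \<gamma>) * qz_ee (bil D Q \<gamma> h))"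
    if h: "h \<in> H" for h
  proof -
    have hc: "h \<in> carrier D" using H_carrier[OF h] .
    have "bij_betw (\<lambda>\<gamma>. \<gamma> \<otimes> h) (carrier D) (carrier D)"
      by (rule bij_betw_byWitness[where f' = "\<lambda>\<gamma>. \<gamma> \<otimes> inv h"]) (auto simp: m_assoc hc)
    then have "(\<Sum>\<gamma>\<in>carrier D. qz_ee (Q \<gamma>)) = (\<Sum>\<gamma>\<in>carrier D. qz_ee (Q (\<gamma> \<otimes> h)))"
      by (rule sum.reindex_bij_betw[symmetric])
    also have "\<dots> = (\<Sum>\<gamma>\<in>carrier D. qz_ee (Q \<gamma> + bil D Q \<gamma> h))"
      using Q_H[OF h] by (simp add: bil_def)
    finally show ?thesis by (simp add: qz_ee_add)
  qed
  have "of_nat (card H) * (\<Sum>\<gamma>\<in>carrier D. qz_ee (Q \<gamma>)) = (\<Sum>h\<in>H. \<Sum>\<gamma>\<in>carrier D. qz_ee (Q \<gamma>))"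
    by simp
  also have "\<dots> = (\<Sum>h\<in>H. \<Sum>\<gamma>\<in>carrier D. qz_ee (Q \<gamma>) * qz_ee (bil D Q \<gamma> h))"
    by (rule sum.cong[OF refl]) (rule shift)
  also have "\<dots> = (\<Sum>\<gamma>\<in>carrier D. qz_ee (Q \<gamma>) * (\<Sum>h\<in>H. qz_ee (bil D Q \<gamma> h)))"
    by (subst sum.swap) (simp add: sum_distrib_left)
  also have "\<dots> = (\<Sum>\<gamma>\<in>perp. qz_ee (Q \<gamma>) * of_nat (card H))"
    using finite_carrier perp_carrier
    by (intro sum.mono_neutral_cong_right) (auto simp: character_sum_H)
  also have "\<dots> = of_nat (card H) * (\<Sum>\<gamma>\<in>perp. qz_ee (Q \<gamma>))"
    by (simp add: sum_distrib_left mult.commute)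
  finally have "(\<Sum>\<gamma>\<in>carrier D. qz_ee (Q \<gamma>)) = (\<Sum>\<gamma>\<in>perp. qz_ee (Q \<gamma>))"
    using card_H_pos by simp
  also have "\<dots> = (\<Sum>\<alpha>\<in>carrier quot. of_nat (card H) * qz_ee (quot_form Q \<alpha>))"
    unfolding sum_perp
    by (rule sum.cong) (auto simp: carrier_quot sum_coset perp_carrier Q_H_mult quot_form_coset)
  finally show ?thesis by (simp add: sum_distrib_left)
qed

text \<open>Gauss sum and square root both change by the factor \<open>card H\<close>, so the
  predicates under the two definite descriptions agree for every \<open>s\<close>.\<close>

lemma disc_sign_quot: "disc_sign quot (quot_form Q) = disc_sign D Q"
proof -
  have "is_signature quot (quot_form Q) s \<longleftrightarrow> is_signature D Q s" for s
    using card_H_pos by (simp add: is_signature_def gauss_sum_quot sqrt_card_quot mult.assoc)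
  then show ?thesis by (simp add: disc_sign_def)
qed

text \<open>Dividing \<open>upv\<close> by \<open>card H\<close> gives a right inverse of
  \<open>dn\<close>. As \<open>dn\<close> is surjective, this is the only possible action on the
  quotient algebra that \<open>dn\<close> intertwines with \<rho>.\<close>

definition quot_weil ::
  "(int ^ 2 ^ 2 \<Rightarrow> ('a \<Rightarrow> complex) \<Rightarrow> 'a \<Rightarrow> complex) \<Rightarrow> int ^ 2 ^ 2 \<Rightarrow> ('a set \<Rightarrow> complex) \<Rightarrow> 'a set \<Rightarrow> complex"
where
  "quot_weil \<rho> M w = (\<lambda>\<alpha>. 1 / of_nat (card H) * dn (\<rho> M (upv w)) \<alpha>)"

text \<open>Moving up after down past \<open>\<rho> M\<close> leaves down after up after down, where
  down after up is the scalar \<open>card H\<close>.\<close>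

lemma quot_weil_down:
  assumes "weil_representation D Q \<rho>" "M \<in> SL2Z" "v \<in> group_alg D"
  shows "quot_weil \<rho> M (dn v) = dn (\<rho> M v)"
  using card_H_pos by (simp add: quot_weil_def up_down_weil[OF assms] down_up_vec down_mem)

lemma down_surj:
  assumes "w \<in> group_alg quot"
  obtains v where "v \<in> group_alg D" "w = dn v"
proof
  let ?v = "\<lambda>\<gamma>. 1 / of_nat (card H) * upv w \<gamma>"
  have mem: "upv w \<in> group_alg D" using alg_linear_mem[OF up_vec_alg_linear assms] .
  then show "?v \<in> group_alg D" by (simp add: group_alg_def)
  show "w = dn ?v"
    unfolding alg_linear_scale[OF down_alg_linear mem] down_up_vec[OF assms]
    using card_H_pos by simp
qed

lemma down_basis_vec: "x \<in> perp \<Longrightarrow> dn (basis_vec x) = basis_vec (H #> x)"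
proof
  fix \<alpha>
  assume x: "x \<in> perp"
  have "dn (basis_vec x) \<alpha> = (\<Sum>\<gamma>\<in>perp. if \<gamma> = x then basis_vec (H #> x) \<alpha> else 0)"
    unfolding down_def by (intro sum.cong) (auto simp: basis_vec_def)
  then show "dn (basis_vec x) \<alpha> = basis_vec (H #> x) \<alpha>"
    using x finite_perp by simp
qed

text \<open>Unit and product laws descend from \<rho> because every vector of the quotient algebra
  is some \<open>dn v\<close>. For S, the entry at a coset adds up \<open>card H\<close> equal
  entries of \<open>\<rho> matS\<close>, and this factor turns \<open>weil_const\<close> into the
  constant of the quotient.\<close>

lemma weil_quot:
  assumes \<rho>: "weil_representation D Q \<rho>"
  shows "weil_representation quot (quot_form Q) (quot_weil \<rho>)"
proof -
  have lin: "alg_linear quot quot (quot_weil \<rho> M)" if "M \<in> SL2Z" for M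
    \<comment> \<open>A one-element index set expresses the scalar multiple as a linear
      combination.\<close>
    using alg_linear_lincomb[of "{()}" quot quot "\<lambda>_ w. dn (\<rho> M (upv w))" "\<lambda>_. 1 / of_nat (card H)"]
      alg_linear_comp[OF alg_linear_comp[OF up_vec_alg_linear weil_alg_linear[OF \<rho> that]] down_alg_linear]
    by (simp add: quot_weil_def[abs_def])
  have one: "quot_weil \<rho> (mat 1) w = w" if "w \<in> group_alg quot" for w
  proof -
    from that obtain v where v: "v \<in> group_alg D" "w = dn v" by (rule down_surj)
    with \<rho> show ?thesis
      by (simp add: quot_weil_down mat_1_in_SL2Z) (simp add: weil_representation_def)
  qed
  have mult: "quot_weil \<rho> (M ** N) w = quot_weil \<rho> M (quot_weil \<rho> N w)"
    if "w \<in> group_alg quot" "M \<in> SL2Z" "N \<in> SL2Z" for w M N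
  proof -
    from that(1) obtain v where v: "v \<in> group_alg D" "w = dn v" by (rule down_surj)
    have "\<rho> (M ** N) v = \<rho> M (\<rho> N v)"
      using \<rho> v that by (simp add: weil_representation_def)
    then show ?thesis
      using \<rho> v that alg_linear_mem[OF weil_alg_linear[OF \<rho>]]
      by (simp add: quot_weil_down mult_in_SL2Z)
  qed
  have T: "quot_weil \<rho> matT (basis_vec \<alpha>) = (\<lambda>\<delta>. qz_ee (quot_form Q \<alpha>) * basis_vec \<alpha> \<delta>)"
    if "\<alpha> \<in> carrier quot" for \<alpha>
  proof -
    from that obtain x where x: "x \<in> perp" "\<alpha> = H #> x" by (auto simp: carrier_quot)
    have e: "basis_vec x \<in> group_alg D" using x perp_carrier by (simp add: group_alg_basis_vec)
    have "quot_weil \<rho> matT (basis_vec \<alpha>) = dn (\<rho> matT (basis_vec x))"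
      using quot_weil_down[OF \<rho> matT_in_SL2Z e] x by (simp add: down_basis_vec)
    also have "\<rho> matT (basis_vec x) = (\<lambda>\<delta>. qz_ee (Q x) * basis_vec x \<delta>)"
      using \<rho> x perp_carrier by (simp add: weil_representation_def)
    finally show ?thesis
      using alg_linear_scale[OF down_alg_linear e] x by (simp add: down_basis_vec quot_form_coset)
  qed
  have S: "quot_weil \<rho> matS (basis_vec \<alpha>) =
      (\<lambda>\<delta>. ee (- of_int (disc_sign quot (quot_form Q)) / 8) / of_real (sqrt (real (card (carrier quot)))) *
        (\<Sum>\<beta>\<in>carrier quot. qz_ee (- bil quot (quot_form Q) \<alpha> \<beta>) * basis_vec \<beta> \<delta>))" (is "_ = ?rhs")
    if \<alpha>: "\<alpha> \<in> carrier quot" for \<alpha>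
  proof (rule quot_alg_eqI)
    from \<alpha> obtain x where x: "x \<in> perp" "\<alpha> = H #> x" by (auto simp: carrier_quot)
    have e: "basis_vec x \<in> group_alg D" using x perp_carrier by (simp add: group_alg_basis_vec)
    show "quot_weil \<rho> matS (basis_vec \<alpha>) \<in> group_alg quot"
      by (rule alg_linear_mem[OF lin[OF matS_in_SL2Z] group_alg_basis_vec[OF \<alpha>]])
    show "?rhs \<in> group_alg quot"
      by (auto simp: group_alg_def basis_vec_def intro!: sum.neutral)
    show "quot_weil \<rho> matS (basis_vec \<alpha>) (H #> y) = ?rhs (H #> y)" if y: "y \<in> perp" for y
    proof -
      have "quot_weil \<rho> matS (basis_vec \<alpha>) (H #> y) = dn (\<rho> matS (basis_vec x)) (H #> y)"
        using quot_weil_down[OF \<rho> matS_in_SL2Z e] x by (simp add: down_basis_vec)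
      also have "\<dots> = (\<Sum>h\<in>H. weil_const * qz_ee (- bil D Q x y))"
      proof -
        have "\<rho> matS (basis_vec x) (h \<otimes> y) = weil_const * qz_ee (- bil D Q x y)" if h: "h \<in> H" for h
        proof -
          have "(\<Sum>\<gamma>\<in>carrier D. qz_ee (- bil D Q \<gamma> (h \<otimes> y)) * basis_vec x \<gamma>) =
              (\<Sum>\<gamma>\<in>carrier D. if \<gamma> = x then qz_ee (- bil D Q x (h \<otimes> y)) else 0)"
            by (intro sum.cong) (auto simp: basis_vec_def)
          also have "\<dots> = qz_ee (- bil D Q x (h \<otimes> y))"
            using finite_carrier x perp_carrier by simp
          also have "bil D Q x (h \<otimes> y) = bil D Q x y"
            using h x y by (simp add: bil_mult_right perp_carrier H_carrier bil_perp)
          finally show ?thesis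
            using h y by (simp add: weil_matS[OF \<rho> e] H_carrier perp_carrier)
        qed
        then show ?thesis using y by (simp add: down_coset)
      qed
      also have "\<dots> = ee (- of_int (disc_sign quot (quot_form Q)) / 8) /
          of_real (sqrt (real (card (carrier quot)))) * qz_ee (- bil quot (quot_form Q) \<alpha> (H #> y))"
        using card_H_pos x y
        by (simp add: weil_const_def disc_sign_quot sqrt_card_quot bil_quot)
      also have "qz_ee (- bil quot (quot_form Q) \<alpha> (H #> y)) =
          (\<Sum>\<beta>\<in>carrier quot. if \<beta> = H #> y then qz_ee (- bil quot (quot_form Q) \<alpha> (H #> y)) else 0)"
        using finite_quot coset_quot[OF y] by simp
      also have "\<dots> = (\<Sum>\<beta>\<in>carrier quot. qz_ee (- bil quot (quot_form Q) \<alpha> \<beta>) * basis_vec \<beta> (H #> y))"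
        by (intro sum.cong) (auto simp: basis_vec_def)
      finally show ?thesis .
    qed
  qed
  show ?thesis
    using lin one mult T S unfolding weil_representation_def alg_linear_def by blast
qed

end

section \<open>Oldforms\<close>

text \<open>The components of the image are fixed linear combinations of those of \<open>F\<close>,
  hence again holomorphic and bounded. \<open>\<rho>'\<close> takes \<rho> as an argument because
  \<open>modular_forms\<close> asserts only the existence of a representation.\<close>

lemma modular_forms_intertwine:
  assumes fin: "finite (carrier D)" and F: "F \<in> modular_forms k D Q"
    and L: "alg_linear D E L"
    and \<rho>': "\<And>\<rho>. weil_representation D Q \<rho> \<Longrightarrow> weil_representation E R (\<rho>' \<rho>)"
    and inter: "\<And>\<rho> M v. weil_representation D Q \<rho> \<Longrightarrow> M \<in> SL2Z \<Longrightarrow> v \<in> group_alg D \<Longrightarrow>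
      \<rho>' \<rho> M (L v) = L (\<rho> M v)"
  shows "(\<lambda>\<tau>. L (F \<tau>)) \<in> modular_forms k E R"
proof -
  have mem: "F \<tau> \<in> group_alg D" if "\<tau> \<in> upper_half_plane" for \<tau>
    using F that by (simp add: modular_forms_def)
  have expand: "L (F \<tau>) \<delta> = (\<Sum>\<gamma>\<in>carrier D. F \<tau> \<gamma> * L (basis_vec \<gamma>) \<delta>)"
    if "\<tau> \<in> upper_half_plane" for \<tau> \<delta>
    using fun_cong[OF alg_linear_expand[OF L fin mem[OF that]]] .
  have hol: "(\<lambda>\<tau>. L (F \<tau>) \<delta>) holomorphic_on upper_half_plane" for \<delta>
  proof -
    have "(\<lambda>\<tau>. \<Sum>\<gamma>\<in>carrier D. F \<tau> \<gamma> * L (basis_vec \<gamma>) \<delta>) holomorphic_on upper_half_plane"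
      using F by (intro holomorphic_intros) (simp add: modular_forms_def)
    then show ?thesis using expand by (simp cong: holomorphic_cong)
  qed
  obtain \<rho> where \<rho>: "weil_representation D Q \<rho>"
    and tr: "\<And>M \<tau>. M \<in> SL2Z \<Longrightarrow> \<tau> \<in> upper_half_plane \<Longrightarrow> F (moebius_act M \<tau>) =
      (\<lambda>\<gamma>. (of_int (M $ 2 $ 1) * \<tau> + of_int (M $ 2 $ 2)) powi k * \<rho> M (F \<tau>) \<gamma>)"
    using F by (auto simp: modular_forms_def)
  have \<rho>_mem: "\<rho> M v \<in> group_alg D" if "M \<in> SL2Z" "v \<in> group_alg D" for M v
    using \<rho> that by (simp add: weil_representation_def)
  have tr': "L (F (moebius_act M \<tau>)) =
      (\<lambda>\<gamma>. (of_int (M $ 2 $ 1) * \<tau> + of_int (M $ 2 $ 2)) powi k * \<rho>' \<rho> M (L (F \<tau>)) \<gamma>)"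
    if "M \<in> SL2Z" "\<tau> \<in> upper_half_plane" for M \<tau>
    unfolding tr[OF that] inter[OF \<rho> that(1) mem[OF that(2)]]
    by (rule alg_linear_scale[OF L \<rho>_mem[OF that(1) mem[OF that(2)]]])
  have bounded: "\<exists>B y. \<forall>\<tau>\<in>upper_half_plane. Im \<tau> \<ge> y \<longrightarrow> norm (L (F \<tau>) \<delta>) \<le> B" for \<delta>
  proof -
    have "\<forall>\<gamma>\<in>carrier D. \<exists>B y. \<forall>\<tau>\<in>upper_half_plane. Im \<tau> \<ge> y \<longrightarrow> norm (F \<tau> \<gamma>) \<le> B"
      using F by (simp add: modular_forms_def)
    then obtain B y where By: "\<And>\<gamma> \<tau>. \<gamma> \<in> carrier D \<Longrightarrow> \<tau> \<in> upper_half_plane \<Longrightarrow> Im \<tau> \<ge> y \<gamma> \<Longrightarrow>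
        norm (F \<tau> \<gamma>) \<le> B \<gamma>"
      by metis
    \<comment> \<open>The sum of absolute values is a common threshold, at least
      \<open>y \<gamma>\<close> for every \<gamma> whatever the signs.\<close>
    have "norm (L (F \<tau>) \<delta>) \<le> (\<Sum>\<gamma>\<in>carrier D. B \<gamma> * norm (L (basis_vec \<gamma>) \<delta>))"
      if \<tau>: "\<tau> \<in> upper_half_plane" "Im \<tau> \<ge> (\<Sum>\<gamma>\<in>carrier D. \<bar>y \<gamma>\<bar>)" for \<tau>
      unfolding expand[OF \<tau>(1)]
    proof (rule sum_norm_le)
      fix \<gamma> assume \<gamma>: "\<gamma> \<in> carrier D"
      have "y \<gamma> \<le> \<bar>y \<gamma>\<bar>" by simp
      also have "\<dots> \<le> (\<Sum>\<gamma>\<in>carrier D. \<bar>y \<gamma>\<bar>)" using \<gamma> fin by (intro member_le_sum) auto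
      finally have "norm (F \<tau> \<gamma>) \<le> B \<gamma>" using By[OF \<gamma> \<tau>(1)] \<tau>(2) by simp
      then show "norm (F \<tau> \<gamma> * L (basis_vec \<gamma>) \<delta>) \<le> B \<gamma> * norm (L (basis_vec \<gamma>) \<delta>)"
        by (simp add: norm_mult mult_right_mono)
    qed
    then show ?thesis by blast
  qed
  show ?thesis
    unfolding modular_forms_def
    using alg_linear_mem[OF L mem] hol \<rho>'[OF \<rho>] tr' bounded by blast
qed

theorem theorem4p4:
  fixes D :: "'a monoid" and Q :: "'a \<Rightarrow> qz" and k :: int
    and n :: nat and H :: "nat \<Rightarrow> 'a set" and F :: "complex \<Rightarrow> 'a \<Rightarrow> complex"
  assumes "discriminant_form D Q"
    and "even_signature D Q"
    and "\<And>i. i \<in> {1..n} \<Longrightarrow> isotropic_subgroup D Q (H i)"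
    and "F \<in> modular_forms k D Q"
  shows "oldform k D Q n H F \<longleftrightarrow> ker_down D Q n H \<subseteq> ker_form_map D F"
proof -
  interpret disc_form D Q
    by unfold_locales (rule assms(1))
  have iso: "isotropic D Q (H i)" if "i \<in> {1..n}" for i
    by unfold_locales (rule assms(3)[OF that])
  let ?up = "\<lambda>i. up_vec D Q (H i)" and ?dn = "\<lambda>i. down D Q (H i)"
  let ?quot = "\<lambda>i. quot_group D Q (H i)"
  note adj = isotropic.up_down_adjoint[OF iso]
  have F_mem: "F \<tau> \<in> group_alg D" if "\<tau> \<in> upper_half_plane" for \<tau>
    using assms(4) that by (simp add: modular_forms_def)
  show ?thesis
  proof
    assume "oldform k D Q n H F"
    then obtain G where G: "\<And>\<tau>. \<tau> \<in> upper_half_plane \<Longrightarrow>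
        F \<tau> = (\<lambda>\<gamma>. \<Sum>i=1..n. up D Q (H i) (G i) \<tau> \<gamma>)"
      by (auto simp: oldform_def)
    \<comment> \<open>By transposition, the pairing of \<open>v\<close> with a lifted vector is the
      pairing of \<open>?dn i v = 0\<close> with the original one.\<close>
    have "form_map D F v \<tau> = 0" if v: "v \<in> ker_down D Q n H" and \<tau>: "\<tau> \<in> upper_half_plane" for v \<tau>
    proof -
      have "form_map D F v \<tau> = (\<Sum>i=1..n. \<Sum>\<gamma>\<in>carrier D. v \<gamma> * ?up i (G i \<tau>) \<gamma>)"
        by (subst sum.swap)
          (simp add: form_map_def G[OF \<tau>] isotropic.up_eq_up_vec[OF iso] sum_distrib_left)
      also have "\<dots> = 0"
        using v by (intro sum.neutral) (simp add: adj ker_down_def)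
      finally show ?thesis .
    qed
    then show "ker_down D Q n H \<subseteq> ker_form_map D F"
      by (auto simp: ker_form_map_def ker_down_def)
  next
    assume ker: "ker_down D Q n H \<subseteq> ker_form_map D F"
    \<comment> \<open>The factor 1 gives the shape that \<open>alg_linear_lincomb\<close> and
      \<open>alg_linear_sum\<close> expect.\<close>
    define A where "A v = (\<lambda>\<gamma>. \<Sum>i=1..n. 1 * ?up i (?dn i v) \<gamma>)" for v
    have P: "alg_linear D D (\<lambda>v. ?up i (?dn i v))" if "i \<in> {1..n}" for i
      by (rule alg_linear_comp[OF isotropic.down_alg_linear[OF iso[OF that]]
            isotropic.up_vec_alg_linear[OF iso[OF that]]])
    have A: "alg_linear D D A"
      unfolding A_def using P by (rule alg_linear_lincomb)
    \<comment> \<open>The bilinear form of \<open>A\<close> is a sum of pairings of down images: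
      symmetry can be read off, and positivity follows on inserting a conjugate.\<close>
    have A_form: "(\<Sum>\<gamma>\<in>carrier D. x \<gamma> * A y \<gamma>) = (\<Sum>i=1..n. \<Sum>\<alpha>\<in>carrier (?quot i). ?dn i x \<alpha> * ?dn i y \<alpha>)"
      for x y
    proof -
      have "(\<Sum>\<gamma>\<in>carrier D. x \<gamma> * A y \<gamma>) = (\<Sum>i=1..n. \<Sum>\<gamma>\<in>carrier D. x \<gamma> * ?up i (?dn i y) \<gamma>)"
        by (subst sum.swap) (simp add: A_def sum_distrib_left)
      then show ?thesis by (simp add: adj)
    qed
    have sym: "(\<Sum>\<gamma>\<in>carrier D. A x \<gamma> * y \<gamma>) = (\<Sum>\<gamma>\<in>carrier D. x \<gamma> * A y \<gamma>)" for x y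
      using A_form[of y x] A_form[of x y] by (simp add: mult.commute)
    have cnj_dn: "?dn i (\<lambda>\<gamma>. cnj (x \<gamma>)) = (\<lambda>\<alpha>. cnj (?dn i x \<alpha>))" if "i \<in> {1..n}" for i x
      by (simp add: isotropic.down_eq[OF iso[OF that]] fun_eq_iff)
    have real: "A (\<lambda>\<gamma>. cnj (x \<gamma>)) = (\<lambda>\<gamma>. cnj (A x \<gamma>))" for x
      by (auto simp: A_def cnj_dn up_vec_def fun_eq_iff intro!: sum.cong)
    \<comment> \<open>A vanishing sum of squared norms makes each \<open>?dn i z\<close>
      vanish.\<close>
    have ker_A: "z \<in> ker_down D Q n H" if z: "z \<in> group_alg D" and "A z = (\<lambda>_. 0)" for z
    proof -
      let ?s = "\<lambda>i. \<Sum>\<alpha>\<in>carrier (?quot i). (norm (?dn i z \<alpha>))\<^sup>2"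
      have sq: "(\<Sum>\<alpha>\<in>carrier (?quot i). cnj (?dn i z \<alpha>) * ?dn i z \<alpha>) = of_real (?s i)" for i
        by (simp add: complex_norm_square[symmetric] mult.commute)
      have "of_real (\<Sum>i=1..n. ?s i) = (\<Sum>i=1..n. of_real (?s i))"
        by (rule of_real_sum)
      also have "\<dots> = (\<Sum>\<gamma>\<in>carrier D. cnj (z \<gamma>) * A z \<gamma>)"
        unfolding A_form by (rule sum.cong) (simp_all only: cnj_dn sq)
      also have "\<dots> = 0" using that by simp
      finally have "(\<Sum>i=1..n. ?s i) = 0" using of_real_eq_0_iff by blast
      then have s0: "?s i = 0" if "i \<in> {1..n}" for i
        using that by (simp add: sum_nonneg_eq_0_iff sum_nonneg)
      have "?dn i z = (\<lambda>_. 0)" if i: "i \<in> {1..n}" for i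
        using sum_cnj_mult_eq_0_iff[OF isotropic.finite_quot[OF iso[OF i]]
            isotropic.down_mem[OF iso[OF i]]] sq[of i] s0[OF i] by simp
      then show ?thesis using z by (simp add: ker_down_def)
    qed
    obtain J :: "nat set" and b where
      J: "finite J" and AB: "\<And>y. y \<in> group_alg D \<Longrightarrow>
       (\<And>z. z \<in> group_alg D \<Longrightarrow> A z = (\<lambda>_. 0) \<Longrightarrow> (\<Sum>\<gamma>\<in>carrier D. z \<gamma> * y \<gamma>) = 0) \<Longrightarrow>
       A (\<lambda>\<gamma>. \<Sum>j\<in>J. b j * (A ^^ j) y \<gamma>) = y"
      by (rule symmetric_polynomial_inverse[OF finite_carrier A sym real]) blast
    define B where "B y = (\<lambda>\<gamma>. \<Sum>j\<in>J. b j * (A ^^ j) y \<gamma>)" for y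
    have B: "alg_linear D D B"
      unfolding B_def by (intro alg_linear_lincomb alg_linear_funpow A)
    have AB_F: "A (B (F \<tau>)) = F \<tau>" if \<tau>: "\<tau> \<in> upper_half_plane" for \<tau>
      unfolding B_def
    proof (rule AB[OF F_mem[OF \<tau>]])
      fix z assume "z \<in> group_alg D" "A z = (\<lambda>_. 0)"
      then have "z \<in> ker_form_map D F" using ker_A ker by blast
      then show "(\<Sum>\<gamma>\<in>carrier D. z \<gamma> * F \<tau> \<gamma>) = 0"
        using \<tau> by (simp add: ker_form_map_def form_map_def)
    qed
    have A_weil: "\<rho> M (A v) = A (\<rho> M v)"
      if \<rho>: "weil_representation D Q \<rho>" and M: "M \<in> SL2Z" and v: "v \<in> group_alg D" for \<rho> M v
    proof -
      have "\<rho> M (A v) = (\<lambda>\<gamma>. \<Sum>i=1..n. 1 * \<rho> M (?up i (?dn i v)) \<gamma>)"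
        unfolding A_def
        by (rule alg_linear_sum[OF weil_alg_linear[OF \<rho> M]]) (use alg_linear_mem[OF P v] in auto)
      then show ?thesis
        using isotropic.up_down_weil[OF iso \<rho> M v] by (simp add: A_def)
    qed
    have pow_weil: "\<rho> M ((A ^^ j) v) = (A ^^ j) (\<rho> M v)"
      if \<rho>: "weil_representation D Q \<rho>" and M: "M \<in> SL2Z" and v: "v \<in> group_alg D" for \<rho> M v j
      by (induction j) (simp_all add: A_weil[OF \<rho> M alg_linear_mem[OF alg_linear_funpow[OF A] v]])
    have B_weil: "\<rho> M (B v) = B (\<rho> M v)"
      if \<rho>: "weil_representation D Q \<rho>" and M: "M \<in> SL2Z" and v: "v \<in> group_alg D" for \<rho> M v
      unfolding B_def
      using alg_linear_sum[OF weil_alg_linear[OF \<rho> M] J alg_linear_mem[OF alg_linear_funpow[OF A] v], of b]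
      by (simp add: pow_weil[OF \<rho> M v])
    define G where "G i \<tau> = ?dn i (B (F \<tau>))" for i \<tau>
    have "G i \<in> modular_forms k (?quot i) (quot_form Q)" if "i \<in> {1..n}" for i
    proof -
      interpret isotropic D Q "H i" by (rule iso[OF that])
      show ?thesis
        unfolding G_def
      \<comment> \<open>One intertwiner does it all: \<open>B\<close> commutes with \<rho>, and
        \<open>?dn i\<close> carries \<rho> to \<open>quot_weil \<rho>\<close>.\<close>
      proof (rule modular_forms_intertwine[where L = "\<lambda>v. ?dn i (B v)", OF finite_carrier assms(4)])
        show "alg_linear D (?quot i) (\<lambda>v. ?dn i (B v))"
          by (rule alg_linear_comp[OF B down_alg_linear])
        show "weil_representation (?quot i) (quot_form Q) (quot_weil \<rho>)"
          if "weil_representation D Q \<rho>" for \<rho>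
          by (rule weil_quot[OF that])
        show "quot_weil \<rho> M (?dn i (B v)) = ?dn i (B (\<rho> M v))"
          if "weil_representation D Q \<rho>" "M \<in> SL2Z" "v \<in> group_alg D" for \<rho> M v
          using quot_weil_down[OF that(1,2) alg_linear_mem[OF B that(3)]] B_weil[OF that] by simp
      qed
    qed
    moreover have "F \<tau> = (\<lambda>\<gamma>. \<Sum>i=1..n. up D Q (H i) (G i) \<tau> \<gamma>)" if "\<tau> \<in> upper_half_plane" for \<tau>
      using AB_F[OF that] by (simp add: A_def G_def isotropic.up_eq_up_vec[OF iso])
    ultimately show "oldform k D Q n H F"
      unfolding oldform_def by blast
  qed
qed

end
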